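(* Let $a_n,b_n,c_n:\mathbb{R}\to\mathbb{C}$ ($n\in\mathbb{N}$) be differentiable functions of $t\in\mathbb{R}$. Assume that the sequence $\{a_n,b_n,c_n\}_{n\in\mathbb{N}}$ is uniformly bounded, i.e. there exists $K\in\mathbb{R}_+$ such that $\max\{|a_n(t)|,|b_n(t)|,|c_n(t)|\}\le K$ for all $n\in\mathbb{N}$ and $t\in\mathbb{R}$, and that $c_n(t)\neq 0$ for all $n\in\mathbb{N}$ and $t\in\mathbb{R}$. Let $J$, $J_-$, $\mathcal{R}_J$, $B_n$, $C_n$, $\mathcal{B}_n$ be the objects associated with this sequence as in the context. Then the following conditions are equivalent: (a) $\{a_n,b_n,c_n\}_{n\in\mathbb{N}}$ is a solution of the system $$\dot a_n=b_n-b_{n-1},\qquad \dot b_n=b_n(a_{n+1}-a_n)+c_n-c_{n-1},\qquad \dot c_n=c_n(a_{n+2}-a_n),\qquad n\in\mathbb{N},$$ with $b_0\equiv 0$, $c_0\equiv 0$; that is, $\dot J=[J,J_-]$. (b) For each $n\in\mathbb{N}\cup\{0\}$, $$\frac{d}{dt}J^n_{11}=J^{n+1}_{11}-J^n_{11}B_1+[J^n_{11},(J_-)_{11}].$$ (c) For all $z\in\mathbb{C}$ such that $|z|>\|J\|$, $$\dot{\mathcal{R}}_J(z)=\mathcal{R}_J(z)(zI_2-B_1)-I_2+[\mathcal{R}_J(z),(J_-)_{11}].$$ (d) For each $n\in\mathbb{N}\cup\{0\}$, the vector polynomial $\mathcal{B}_n$ satisfies $$\dot{\mathcal{B}}_n(z)=-C_n\mathcal{B}_{n-1}(z)-D_n\mathcal{B}_n(z),\qquad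 D_n=\begin{pmatrix}0&0\\ b_{2n+1}&0\end{pmatrix}.$$
   Context: $\mathbb{N}=\{1,2,\dots\}$. The dot and $\frac{d}{dt}$ denote differentiation with respect to $t\in\mathbb{R}$; the dependence on $t$ is suppressed in the notation. $[M,N]=MN-NM$. $I_2$ is the $2\times2$ identity matrix. $J=J(t)$ is the infinite matrix (rows and columns indexed by $1,2,\dots$) with $J_{n,n}=a_n$, $J_{n,n+1}=1$, $J_{n+1,n}=b_n$, $J_{n+2,n}=c_n$ for $n\in\mathbb{N}$ and all other entries zero; $J_-$ is its strictly lower triangular part. Infinite matrices are identified with operators on $\ell^2$ (canonical basis), and $\|J\|$ is the operator norm. For an infinite matrix $M$, $M_{ij}$ denotes the $2\times2$ block formed by rows $2i-1,2i$ and columns $2j-1,2j$; $J^n_{11}$ means $(J^n)_{11}$. In particular $(J_-)_{11}=\begin{pmatrix}0&0\\ b_1&0\end{pmatrix}$. For $|z|>\|J\|$, $\mathcal{R}_J(z)=\big((zI-J)^{-1}\big)_{11}=\sum_{n\ge0}\frac{J^n_{11}}{z^{n+1}}$. The polynomials $P_n$ are defined by $P_0=1$, $P_{-1}=P_{-2}=0$ and $c_{n-1}P_{n-2}(z)+b_nP_{n-1}(z)+(a_{n+1}-z)P_n(z)+P_{n+1}(z)=0$ for $n=0,1,\dots$ (terms containing $P_{-1}$ or $P_{-2}$ vanish). Put $\mathcal{B}_m(z)=(P_{2m}(z),P_{2m+1}(z))^T$ for $m\ge 0$ and $\mathcal{B}_{-1}=0$. Equivalently, $C_n\mathcal{B}_{n-1}(z)+(B_{n+1}-zI_2)\mathcal{B}_n(z)+A\mathcal{B}_{n+1}(z)=0$,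 $n=0,1,\dots$, with $\mathcal{B}_{-1}=0$, $\mathcal{B}_0(z)=(1,z-a_1)^T$, where $$A=\begin{pmatrix}0&0\\1&0\end{pmatrix},\quad C_n=\begin{pmatrix}c_{2n-1}&b_{2n}\\0&c_{2n}\end{pmatrix},\quad B_n=\begin{pmatrix}a_{2n-1}&1\\ b_{2n-1}&a_{2n}\end{pmatrix},\quad n\in\mathbb{N},$$ and $C_0$ is an arbitrary $2\times2$ matrix (irrelevant since it multiplies $\mathcal{B}_{-1}=0$). The derivative $\dot{\mathcal{B}}_n(z)$ is taken with respect to $t$ for fixed $z$. *)

theory Defs
  imports "HOL-Analysis.Analysis" "HOL-Computational_Algebra.Polynomial"
begin

text \<open>
  The index set of matrices and of square-summable sequences is \<open>nat\<close>, so the entry in row \<open>p\<close> and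
  column \<open>q\<close> of an infinite matrix (\<open>p, q \<ge> 1\<close>) is \<open>M (p - 1) (q - 1)\<close>.  The coefficient
  sequences \<open>a, b, c\<close> and the blocks keep their numbering from 1.
\<close>

type_synonym inf_matrix = "nat \<Rightarrow> nat \<Rightarrow> complex"

definition imat_one :: inf_matrix where
  "imat_one i j = (if i = j then 1 else 0)"

definition imat_mult :: "inf_matrix \<Rightarrow> inf_matrix \<Rightarrow> inf_matrix" where
  "imat_mult M N i j = (\<Sum>k. M i k * N k j)"

primrec imat_power :: "inf_matrix \<Rightarrow> nat \<Rightarrow> inf_matrix" where
  "imat_power M 0 = imat_one"
| "imat_power M (Suc n) = imat_mult M (imat_power M n)"

definition imat_commutator :: "inf_matrix \<Rightarrow> inf_matrix \<Rightarrow> inf_matrix" where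
  "imat_commutator M N i j = imat_mult M N i j - imat_mult N M i j"

definition mat2 :: "complex \<Rightarrow> complex \<Rightarrow> complex \<Rightarrow> complex \<Rightarrow> complex^2^2" where
  "mat2 p q r s = vector [vector [p, q], vector [r, s]]"

definition commutator2 :: "complex^2^2 \<Rightarrow> complex^2^2 \<Rightarrow> complex^2^2" where
  "commutator2 M N = M ** N - N ** M"

text \<open>Rows \<open>2 p - 1, 2 p\<close> and columns \<open>2 q - 1, 2 q\<close> (\<open>p, q \<ge> 1\<close>), shifted to indices from 0.\<close>

definition block :: "inf_matrix \<Rightarrow> nat \<Rightarrow> nat \<Rightarrow> complex^2^2" where
  "block M p q = mat2 (M (2*p - 2) (2*q - 2)) (M (2*p - 2) (2*q - 1))
                      (M (2*p - 1) (2*q - 2)) (M (2*p - 1) (2*q - 1))"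

definition ell2 :: "(nat \<Rightarrow> complex) set" where
  "ell2 = {x. summable (\<lambda>n. (cmod (x n))\<^sup>2)}"

definition ell2_norm :: "(nat \<Rightarrow> complex) \<Rightarrow> real" where
  "ell2_norm x = sqrt (\<Sum>n. (cmod (x n))\<^sup>2)"

definition imat_apply :: "inf_matrix \<Rightarrow> (nat \<Rightarrow> complex) \<Rightarrow> nat \<Rightarrow> complex" where
  "imat_apply M x i = (\<Sum>j. M i j * x j)"

text \<open>Meaningful for matrices that define bounded operators on \<open>ell2\<close>.\<close>

definition imat_norm :: "inf_matrix \<Rightarrow> real" where
  "imat_norm M = (SUP x\<in>{x \<in> ell2. ell2_norm x \<le> 1}. ell2_norm (imat_apply M x))"

text \<open>
  The matrix, in the canonical basis, of the inverse of the operator on \<open>ell2\<close> given by \<open>M\<close>: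
  column \<open>j\<close> is the preimage of the \<open>j\<close>-th basis vector.
\<close>

definition imat_inverse :: "inf_matrix \<Rightarrow> inf_matrix" where
  "imat_inverse M i j = inv_into ell2 (imat_apply M) (\<lambda>k. if k = j then 1 else 0) i"

definition jacobi ::
  "(nat \<Rightarrow> real \<Rightarrow> complex) \<Rightarrow> (nat \<Rightarrow> real \<Rightarrow> complex) \<Rightarrow> (nat \<Rightarrow> real \<Rightarrow> complex) \<Rightarrow> real \<Rightarrow> inf_matrix" where
  "jacobi a b c t i j =
     (if j = i then a (i + 1) t
      else if j = i + 1 then 1
      else if i = j + 1 then b (j + 1) t
      else if i = j + 2 then c (j + 1) t
      else 0)"

definition lower_part :: "inf_matrix \<Rightarrow> inf_matrix" where
  "lower_part M i j = (if j < i then M i j else 0)"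

definition resolvent_block :: "inf_matrix \<Rightarrow> complex \<Rightarrow> complex^2^2" where
  "resolvent_block M z = block (imat_inverse (\<lambda>i j. z * imat_one i j - M i j)) 1 1"

definition B_mat ::
  "(nat \<Rightarrow> real \<Rightarrow> complex) \<Rightarrow> (nat \<Rightarrow> real \<Rightarrow> complex) \<Rightarrow> real \<Rightarrow> nat \<Rightarrow> complex^2^2" where
  "B_mat a b t n = mat2 (a (2*n - 1) t) 1 (b (2*n - 1) t) (a (2*n) t)"

text \<open>The value at \<open>n = 0\<close> is irrelevant, since it only ever multiplies the zero vector.\<close>

definition C_mat ::
  "(nat \<Rightarrow> real \<Rightarrow> complex) \<Rightarrow> (nat \<Rightarrow> real \<Rightarrow> complex) \<Rightarrow> real \<Rightarrow> nat \<Rightarrow> complex^2^2" where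
  "C_mat b c t n = mat2 (c (2*n - 1) t) (b (2*n) t) 0 (c (2*n) t)"

definition D_mat :: "(nat \<Rightarrow> real \<Rightarrow> complex) \<Rightarrow> real \<Rightarrow> nat \<Rightarrow> complex^2^2" where
  "D_mat b t n = mat2 0 0 (b (2*n + 1) t) 0"

text \<open>
  The recurrence \<open>c\<^bsub>n-1\<^esub> P\<^bsub>n-2\<^esub> + b\<^sub>n P\<^bsub>n-1\<^esub> + (a\<^bsub>n+1\<^esub> - z) P\<^sub>n + P\<^bsub>n+1\<^esub> = 0\<close> solved for
  \<open>P\<^bsub>n+1\<^esub>\<close>; the terms with \<open>P\<^bsub>-1\<^esub> = P\<^bsub>-2\<^esub> = 0\<close> are dropped for \<open>n = 0, 1\<close>.
\<close>

fun rec_poly ::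
  "(nat \<Rightarrow> real \<Rightarrow> complex) \<Rightarrow> (nat \<Rightarrow> real \<Rightarrow> complex) \<Rightarrow> (nat \<Rightarrow> real \<Rightarrow> complex) \<Rightarrow> real \<Rightarrow> nat \<Rightarrow> complex poly" where
  "rec_poly a b c t 0 = 1"
| "rec_poly a b c t (Suc 0) = [:- a 1 t, 1:]"
| "rec_poly a b c t (Suc (Suc 0)) =
     [:- a 2 t, 1:] * rec_poly a b c t (Suc 0) - smult (b 1 t) (rec_poly a b c t 0)"
| "rec_poly a b c t (Suc (Suc (Suc n))) =
     [:- a (n + 3) t, 1:] * rec_poly a b c t (Suc (Suc n))
     - smult (b (n + 2) t) (rec_poly a b c t (Suc n))
     - smult (c (n + 1) t) (rec_poly a b c t n)"

definition vec_poly ::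
  "(nat \<Rightarrow> real \<Rightarrow> complex) \<Rightarrow> (nat \<Rightarrow> real \<Rightarrow> complex) \<Rightarrow> (nat \<Rightarrow> real \<Rightarrow> complex) \<Rightarrow> real \<Rightarrow> int \<Rightarrow> complex \<Rightarrow> complex^2" where
  "vec_poly a b c t m z =
     (if m < 0 then 0
      else vector [poly (rec_poly a b c t (2 * nat m)) z, poly (rec_poly a b c t (2 * nat m + 1)) z])"

definition toda_system ::
  "(nat \<Rightarrow> real \<Rightarrow> complex) \<Rightarrow> (nat \<Rightarrow> real \<Rightarrow> complex) \<Rightarrow> (nat \<Rightarrow> real \<Rightarrow> complex) \<Rightarrow> bool" where
  "toda_system a b c \<longleftrightarrow>
     (\<forall>n\<ge>1. \<forall>t.
        (a n has_vector_derivative (b n t - b (n - 1) t)) (at t) \<and>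
        (b n has_vector_derivative (b n t * (a (n + 1) t - a n t) + c n t - c (n - 1) t)) (at t) \<and>
        (c n has_vector_derivative (c n t * (a (n + 2) t - a n t))) (at t))"

definition lax_equation ::
  "(nat \<Rightarrow> real \<Rightarrow> complex) \<Rightarrow> (nat \<Rightarrow> real \<Rightarrow> complex) \<Rightarrow> (nat \<Rightarrow> real \<Rightarrow> complex) \<Rightarrow> bool" where
  "lax_equation a b c \<longleftrightarrow>
     (\<forall>t i j. ((\<lambda>s. jacobi a b c s i j) has_vector_derivative
        imat_commutator (jacobi a b c t) (lower_part (jacobi a b c t)) i j) (at t))"

definition moment_equation ::
  "(nat \<Rightarrow> real \<Rightarrow> complex) \<Rightarrow> (nat \<Rightarrow> real \<Rightarrow> complex) \<Rightarrow> (nat \<Rightarrow> real \<Rightarrow> complex) \<Rightarrow> bool" where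
  "moment_equation a b c \<longleftrightarrow>
     (\<forall>n t. ((\<lambda>s. block (imat_power (jacobi a b c s) n) 1 1) has_vector_derivative
        (block (imat_power (jacobi a b c t) (n + 1)) 1 1
         - block (imat_power (jacobi a b c t) n) 1 1 ** B_mat a b t 1
         + commutator2 (block (imat_power (jacobi a b c t) n) 1 1)
                       (block (lower_part (jacobi a b c t)) 1 1))) (at t))"

definition resolvent_equation ::
  "(nat \<Rightarrow> real \<Rightarrow> complex) \<Rightarrow> (nat \<Rightarrow> real \<Rightarrow> complex) \<Rightarrow> (nat \<Rightarrow> real \<Rightarrow> complex) \<Rightarrow> bool" where
  "resolvent_equation a b c \<longleftrightarrow>
     (\<forall>t z. cmod z > imat_norm (jacobi a b c t) \<longrightarrow>
        ((\<lambda>s. resolvent_block (jacobi a b c s) z) has_vector_derivative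
        (resolvent_block (jacobi a b c t) z ** (mat z - B_mat a b t 1) - mat 1
         + commutator2 (resolvent_block (jacobi a b c t) z)
                       (block (lower_part (jacobi a b c t)) 1 1))) (at t))"

definition vec_poly_equation ::
  "(nat \<Rightarrow> real \<Rightarrow> complex) \<Rightarrow> (nat \<Rightarrow> real \<Rightarrow> complex) \<Rightarrow> (nat \<Rightarrow> real \<Rightarrow> complex) \<Rightarrow> bool" where
  "vec_poly_equation a b c \<longleftrightarrow>
     (\<forall>n t z. ((\<lambda>s. vec_poly a b c s (int n) z) has_vector_derivative
        (- (C_mat b c t n *v vec_poly a b c t (int n - 1) z)
         - D_mat b t n *v vec_poly a b c t (int n) z)) (at t))"

end

theory Submission
  imports Defs
begin

text \<open>
  Let \<open>E = J' - [J, L]\<close>, where \<open>J'\<close> is the derivative of \<open>J\<close> and \<open>L = J\<^sub>-\<close>; the system says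
  \<open>E = 0\<close>.  The map \<open>M \<mapsto> M' - [M, L]\<close> is a derivation, so its values \<open>X\<^sub>n\<close> on the powers of \<open>J\<close>
  satisfy \<open>X\<^bsub>n+1\<^esub> = E J\<^sup>n + J X\<^sub>n\<close>.  Since \<open>L\<close> is strictly lower triangular and \<open>J - L\<close> is upper
  triangular, the moment equations say exactly that the leading \<open>2 \<times> 2\<close> blocks of all \<open>X\<^sub>n\<close> vanish.
  If the entries of \<open>E\<close> before position \<open>(i, j)\<close> in row-major order vanish (indices
  from 0), then for \<open>n = i + \<lfloor>j/2\<rfloor> + 1\<close> and \<open>q = j mod 2\<close> the entry \<open>(0, q)\<close> of \<open>X\<^sub>n\<close> is \<open>E\<^sub>i\<^sub>j\<close> times a product
  of the nonzero numbers \<open>c\<^sub>k\<close>; hence the blocks determine \<open>E\<close>.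

  The resolvent is the generating function of the moments.  Along a solution \<open>J\<close> is Lipschitz in
  operator norm, so its Neumann series may be differentiated termwise.  Conversely, for \<open>|z|\<close> above a
  bound of \<open>\<parallel>J\<parallel>\<close> uniform in \<open>t\<close>, one integrates in \<open>t\<close> and compares coefficients: the series
  cannot be differentiated termwise, as no bound on the derivatives of its coefficients is known.

  For the polynomials, the recurrence reads \<open>J P = z P\<close> and the claim is \<open>P' = - L P\<close>.  Differentiating
  the recurrence gives \<open>E P = 0\<close>, and \<open>E = 0\<close> follows since the \<open>P\<^sub>n\<close> are linearly independent.
\<close>

section \<open>Infinite matrices of bounded upper bandwidth\<close>

text \<open>Row \<open>i\<close> is supported in columns up to \<open>i + p\<close>, so products
  reduce to finite sums without any convergence question. No lower band is imposed, hence lower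
  parts and powers remain in such a class.\<close>

definition upper_band :: "nat \<Rightarrow> inf_matrix \<Rightarrow> bool" where
  "upper_band p M \<longleftrightarrow> (\<forall>i j. i + p < j \<longrightarrow> M i j = 0)"

lemma imat_mult_sum:
  assumes "upper_band p M" "i + p < n"
  shows "imat_mult M N i j = (\<Sum>k<n. M i k * N k j)"
  unfolding imat_mult_def
  by (rule suminf_finite) (use assms in \<open>auto simp: upper_band_def\<close>)

lemma upper_band_imat_mult:
  assumes "upper_band p M" "upper_band q N"
  shows "upper_band (p + q) (imat_mult M N)"
  unfolding upper_band_def
proof (intro allI impI)
  fix i j assume ij: "i + (p + q) < (j::nat)"
  have "imat_mult M N i j = (\<Sum>k<i + p + 1. M i k * N k j)"
    by (rule imat_mult_sum) (use assms in auto)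
  also have "\<dots> = 0"
    by (rule sum.neutral) (use assms ij in \<open>auto simp: upper_band_def\<close>)
  finally show "imat_mult M N i j = 0" .
qed

lemma imat_mult_assoc:
  assumes M: "upper_band p M" and N: "upper_band q N"
  shows "imat_mult (imat_mult M N) K = imat_mult M (imat_mult N K)"
proof (intro ext)
  fix i j
  define n where "n = i + p + q + 1"
  have "imat_mult (imat_mult M N) K i j = (\<Sum>k<n. imat_mult M N i k * K k j)"
    by (rule imat_mult_sum[OF upper_band_imat_mult[OF M N]]) (simp add: n_def)
  also have "\<dots> = (\<Sum>k<n. (\<Sum>l<n. M i l * N l k) * K k j)"
    by (intro sum.cong refl, subst imat_mult_sum[OF M, of _ n]) (auto simp: n_def)
  also have "\<dots> = (\<Sum>l<n. M i l * (\<Sum>k<n. N l k * K k j))"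
    by (simp add: sum_distrib_left sum_distrib_right mult.assoc) (rule sum.swap)
  also have "\<dots> = (\<Sum>l<n. M i l * imat_mult N K l j)"
  proof (intro sum.cong refl)
    fix l assume "l \<in> {..<n}"
    show "M i l * (\<Sum>k<n. N l k * K k j) = M i l * imat_mult N K l j"
    \<comment> \<open>For \<open>l > i + p\<close> the cut-off \<open>n\<close> may be too short for
      row \<open>l\<close> of \<open>N\<close>, but then \<open>M i l = 0\<close>.\<close>
    proof (cases "l \<le> i + p")
      case True
      then show ?thesis by (simp add: imat_mult_sum[OF N, of l n] n_def)
    qed (use M in \<open>auto simp: upper_band_def\<close>)
  qed
  also have "\<dots> = imat_mult M (imat_mult N K) i j"
    by (rule imat_mult_sum[OF M, symmetric]) (simp add: n_def)
  finally show "imat_mult (imat_mult M N) K i j = imat_mult M (imat_mult N K) i j" .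
qed

lemma imat_mult_one_left: "imat_mult imat_one M = M"
proof (intro ext)
  fix i j
  have "imat_mult imat_one M i j = (\<Sum>k<i+1. imat_one i k * M k j)"
    by (rule imat_mult_sum[of 0]) (auto simp: upper_band_def imat_one_def)
  then show "imat_mult imat_one M i j = M i j"
    by (simp add: imat_one_def)
qed

lemma imat_mult_one_right:
  assumes "upper_band p M" shows "imat_mult M imat_one = M"
proof (intro ext)
  fix i j
  have "imat_mult M imat_one i j = (\<Sum>k<i+j+p+1. M i k * imat_one k j)"
    by (rule imat_mult_sum[OF assms]) auto
  also have "\<dots> = (\<Sum>k<i+j+p+1. if k = j then M i k else 0)"
    by (intro sum.cong) (auto simp: imat_one_def)
  also have "\<dots> = M i j" by simp
  finally show "imat_mult M imat_one i j = M i j" .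
qed

lemma upper_band_imat_power:
  assumes "upper_band p M"
  shows "upper_band (n * p) (imat_power M n)"
proof (induction n)
  case 0
  show ?case by (simp add: upper_band_def imat_one_def)
next
  case (Suc n)
  from upper_band_imat_mult[OF assms this] show ?case by simp
qed

text \<open>Powers are built by multiplication on the left; the version on the right shows that
  \<open>M\<close> commutes with its powers, as \<open>imat_commutator_lower_part\<close>
  requires.\<close>

lemma imat_power_Suc_right:
  assumes "upper_band p M"
  shows "imat_power M (Suc n) = imat_mult (imat_power M n) M"
proof (induction n)
  case 0
  show ?case using assms by (simp add: imat_mult_one_left imat_mult_one_right)
next
  case (Suc n)
  have "imat_power M (Suc (Suc n)) = imat_mult M (imat_mult (imat_power M n) M)"
    using Suc by simp
  then show ?case
    by (simp add: imat_mult_assoc[OF assms upper_band_imat_power[OF assms]])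
qed

lemma imat_mult_diff_left:
  assumes "upper_band p M" "upper_band q N"
  shows "imat_mult (\<lambda>i j. M i j - N i j) K i j = imat_mult M K i j - imat_mult N K i j"
proof -
  define n where "n = i + p + q + 1"
  have "upper_band (p + q) (\<lambda>i j. M i j - N i j)"
    using assms by (simp add: upper_band_def)
  then show ?thesis
    by (subst imat_mult_sum[of "p + q" _ _ n], (simp_all add: n_def)[2])
       (simp add: imat_mult_sum[OF assms(1), of _ n] imat_mult_sum[OF assms(2), of _ n]
          n_def left_diff_distrib sum_subtractf)
qed

lemma imat_mult_diff_right:
  assumes "upper_band p M"
  shows "imat_mult M (\<lambda>i j. N i j - K i j) i j = imat_mult M N i j - imat_mult M K i j"
  by (simp add: imat_mult_sum[OF assms, of i "i + p + 1"] right_diff_distrib sum_subtractf)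

section \<open>Derivatives of matrix powers\<close>

primrec imat_power_deriv :: "inf_matrix \<Rightarrow> inf_matrix \<Rightarrow> nat \<Rightarrow> inf_matrix" where
  "imat_power_deriv M M' 0 = (\<lambda>i j. 0)"
| "imat_power_deriv M M' (Suc n) =
     (\<lambda>i j. imat_mult M' (imat_power M n) i j + imat_mult M (imat_power_deriv M M' n) i j)"

text \<open>The width \<open>p\<close> is the same for all \<open>s\<close>, so an entry of the
  product is a sum over a fixed finite range and the product rule applies to each term.\<close>

lemma has_vector_derivative_imat_power:
  assumes band: "\<And>s. upper_band p (M s)" "upper_band p M'"
    and deriv: "\<And>i j. ((\<lambda>s. M s i j) has_vector_derivative M' i j) (at t within S)"
  shows "((\<lambda>s. imat_power (M s) n i j) has_vector_derivative
            imat_power_deriv (M t) M' n i j) (at t within S)"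
proof (induction n arbitrary: i j)
  case (Suc n)
  have "((\<lambda>s. \<Sum>k<i+p+1. M s i k * imat_power (M s) n k j) has_vector_derivative
     (\<Sum>k<i+p+1. M t i k * imat_power_deriv (M t) M' n k j + M' i k * imat_power (M t) n k j))
       (at t within S)"
    by (intro has_vector_derivative_sum has_vector_derivative_mult deriv Suc)
  then show ?case
    by (simp add: imat_mult_sum[OF band(1), of i "i+p+1"] imat_mult_sum[OF band(2), of i "i+p+1"]
       sum.distrib add_ac)
qed simp

text \<open>The value of the derivation \<open>M \<mapsto> M' - [M, L]\<close> on a power of \<open>M\<close>.\<close>

definition power_defect :: "inf_matrix \<Rightarrow> inf_matrix \<Rightarrow> inf_matrix \<Rightarrow> nat \<Rightarrow> inf_matrix" where
  "power_defect M M' L n i j = imat_power_deriv M M' n i j - imat_commutator (imat_power M n) L i j"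

lemma power_defect_0:
  assumes "upper_band q L"
  shows "power_defect M M' L 0 i j = 0"
  by (simp add: power_defect_def imat_commutator_def imat_mult_one_left
      imat_mult_one_right[OF assms])

text \<open>Leibniz rule for the derivation, applied to \<open>M\<close> times its
  \<open>n\<close>-th power: the terms with \<open>L\<close> between the two factors cancel by
  associativity.\<close>

lemma power_defect_Suc:
  fixes M M' L :: inf_matrix
  assumes M: "upper_band p M" and M': "upper_band p M'" and L: "upper_band q L"
  defines "E \<equiv> (\<lambda>i j. M' i j - imat_commutator M L i j)"
  shows "power_defect M M' L (Suc n) i j =
     imat_mult E (imat_power M n) i j + imat_mult M (power_defect M M' L n) i j"
proof -
  let ?P = "imat_power M n"
  note P = upper_band_imat_power[OF M, of n]
  have comm1: "upper_band (p + q) (imat_mult M L)" and comm2: "upper_band (q + p) (imat_mult L M)"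
    by (intro upper_band_imat_mult M L)+
  have E: "imat_mult E ?P i j = imat_mult M' ?P i j
       - (imat_mult (imat_mult M L) ?P i j - imat_mult (imat_mult L M) ?P i j)"
  proof -
    have "upper_band (p + q) (\<lambda>i j. imat_mult M L i j - imat_mult L M i j)"
      using comm1 comm2 by (simp add: upper_band_def)
    from imat_mult_diff_left[OF M' this] imat_mult_diff_left[OF comm1 comm2] show ?thesis
      by (simp add: E_def imat_commutator_def)
  qed
  have X: "imat_mult M (power_defect M M' L n) i j =
     imat_mult M (imat_power_deriv M M' n) i j
     - (imat_mult M (imat_mult ?P L) i j - imat_mult M (imat_mult L ?P) i j)"
    unfolding power_defect_def[abs_def] imat_commutator_def
    by (simp add: imat_mult_diff_right[OF M])
  show ?thesis
    unfolding E X
    by (simp add: power_defect_def imat_commutator_def imat_mult_assoc[OF M P]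
      imat_mult_assoc[OF M L] imat_mult_assoc[OF L M])
qed

section \<open>The Toda system and the powers of \<open>J\<close>\<close>

lemma upper_band_lower_part: "upper_band 0 (lower_part M)"
  by (simp add: upper_band_def lower_part_def)

text \<open>Write \<open>L = lower_part M\<close> and \<open>U = M - L\<close>. Then
  \<open>P L = P M - P U\<close>, where only \<open>k \<le> j\<close> enters \<open>P U\<close>
  because \<open>U\<close> is upper triangular, and only \<open>k < i\<close> enters
  \<open>L P\<close>. For \<open>i, j < 2\<close> both corrections stay in the leading block, which
  is why the moment equations close up.\<close>

lemma imat_commutator_lower_part:
  assumes P: "upper_band p P" and MP: "imat_mult M P = imat_mult P M"
  shows "imat_commutator P (lower_part M) i j =
    imat_mult M P i j - (\<Sum>k\<le>j. P i k * M k j) - (\<Sum>k<i. M i k * P k j)"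
proof -
  define n where "n = i + j + p + 1"
  have "imat_mult P (lower_part M) i j = (\<Sum>k<n. P i k * M k j - (if k \<le> j then P i k * M k j else 0))"
    by (subst imat_mult_sum[OF P, of _ n])
       (auto simp: n_def lower_part_def intro!: sum.cong)
  also have "\<dots> = (\<Sum>k<n. P i k * M k j) - (\<Sum>k<n. if k \<le> j then P i k * M k j else 0)"
    by (rule sum_subtractf)
  also have "(\<Sum>k<n. if k \<le> j then P i k * M k j else 0) = (\<Sum>k\<le>j. P i k * M k j)"
    by (rule sum.mono_neutral_cong_right) (auto simp: n_def)
  also have "(\<Sum>k<n. P i k * M k j) = imat_mult M P i j"
    unfolding MP by (rule imat_mult_sum[OF P, symmetric]) (simp add: n_def)
  finally have *: "imat_mult P (lower_part M) i j = imat_mult M P i j - (\<Sum>k\<le>j. P i k * M k j)" .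
  have "imat_mult (lower_part M) P i j = (\<Sum>k<i+1. lower_part M i k * P k j)"
    by (rule imat_mult_sum[OF upper_band_lower_part]) simp
  also have "\<dots> = (\<Sum>k<i. M i k * P k j)"
    by (simp add: lower_part_def)
  finally show ?thesis
    unfolding imat_commutator_def * by simp
qed

section \<open>The system in Lax form\<close>

locale jacobi_coefficients =
  fixes a b c :: "nat \<Rightarrow> real \<Rightarrow> complex"
  assumes differentiable: "\<And>n t. n \<ge> 1 \<Longrightarrow>
      a n differentiable (at t) \<and> b n differentiable (at t) \<and> c n differentiable (at t)"
    and nonzero: "\<And>n t. n \<ge> 1 \<Longrightarrow> c n t \<noteq> 0"
    and zero: "\<And>t. b 0 t = 0" "\<And>t. c 0 t = 0"
begin

abbreviation "J \<equiv> jacobi a b c"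
abbreviation "L t \<equiv> lower_part (jacobi a b c t)"

lemma upper_band_jacobi: "upper_band 1 (J t)"
  by (simp add: upper_band_def jacobi_def)

lemma jacobi_const: "i < j \<or> j + 2 < i \<Longrightarrow> J t i j = (if j = i + 1 then 1 else 0)"
  by (auto simp: jacobi_def)

text \<open>Since \<open>b\<close> and \<open>c\<close> vanish at 0, truncated subtraction is harmless in the following formulas.\<close>

lemma imat_mult_jacobi:
  "imat_mult (J t) N i j = a (i + 1) t * N i j + N (i + 1) j + b i t * N (i - 1) j + c (i - 1) t * N (i - 2) j"
proof -
  have *: "imat_mult (J t) N i j = (\<Sum>k<i+2. J t i k * N k j)"
    by (rule imat_mult_sum[OF upper_band_jacobi]) simp
  consider "i = 0" | "i = 1" | m where "i = Suc (Suc m)"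
    by (metis One_nat_def not0_implies_Suc)
  then show ?thesis
  proof cases
    case 3
    have "(\<Sum>k<m. J t i k * N k j) = 0"
      by (rule sum.neutral) (auto simp: 3 jacobi_def)
    then show ?thesis unfolding * unfolding 3 by (simp add: jacobi_def)
  next
    case 1
    then show ?thesis unfolding * by (simp add: jacobi_def zero eval_nat_numeral)
  next
    case 2
    then show ?thesis unfolding * by (simp add: jacobi_def zero eval_nat_numeral)
  qed
qed

lemma imat_mult_lower_jacobi:
  "imat_mult (L t) N i j = b i t * N (i - 1) j + c (i - 1) t * N (i - 2) j"
proof -
  have *: "imat_mult (L t) N i j = (\<Sum>k<i+2. L t i k * N k j)"
    by (rule imat_mult_sum[OF upper_band_lower_part]) simp
  consider "i = 0" | "i = 1" | m where "i = Suc (Suc m)"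
    by (metis One_nat_def not0_implies_Suc)
  then show ?thesis
  proof cases
    case 3
    have "(\<Sum>k<m. L t i k * N k j) = 0"
      by (rule sum.neutral) (auto simp: 3 jacobi_def lower_part_def)
    then show ?thesis unfolding * unfolding 3 by (simp add: jacobi_def lower_part_def)
  next
    case 1
    then show ?thesis unfolding * by (simp add: jacobi_def lower_part_def zero eval_nat_numeral)
  next
    case 2
    then show ?thesis unfolding * by (simp add: jacobi_def lower_part_def zero eval_nat_numeral)
  qed
qed

text \<open>\<open>[J, L] = [J - L, L]\<close> with \<open>J - L\<close> upper bidiagonal, so only
  the diagonal and two subdiagonals survive. They carry the right-hand sides of the system for
  \<open>n = j + 1\<close>.\<close>

lemma commutator_jacobi:
  "imat_commutator (J t) (L t) i j =
    (if i = j then b (j + 1) t - b j t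
     else if i = j + 1 then b (j + 1) t * (a (j + 2) t - a (j + 1) t) + c (j + 1) t - c j t
     else if i = j + 2 then c (j + 1) t * (a (j + 3) t - a (j + 1) t)
     else 0)"
proof -
  \<comment> \<open>On the third and fourth subdiagonals both products contain the entries of
    \<open>L * L\<close>, which cancel only in the difference.\<close>
  consider "i < j" | "i = j" | "i = j + 1" | "i = j + 2" | "i = j + 3" | "i = j + 4" | "j + 5 \<le> i"
    by linarith
  then show ?thesis
  proof cases
    case 1
    show ?thesis
      unfolding imat_commutator_def imat_mult_jacobi imat_mult_lower_jacobi
      using 1 by (cases i; cases "i - 1") (simp_all add: lower_part_def jacobi_def zero)
  next
    case 2
    show ?thesis
      unfolding imat_commutator_def imat_mult_jacobi imat_mult_lower_jacobi
      using 2 by (cases i; cases "i - 1") (simp_all add: lower_part_def jacobi_def zero)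
  next
    case 3
    show ?thesis
      unfolding imat_commutator_def imat_mult_jacobi imat_mult_lower_jacobi
      using 3 by (cases j) (simp_all add: lower_part_def jacobi_def zero, simp_all add: algebra_simps)
  next
    case 4
    show ?thesis
      unfolding imat_commutator_def imat_mult_jacobi imat_mult_lower_jacobi
      using 4 by  (simp add: lower_part_def jacobi_def zero, simp add: algebra_simps numeral_3_eq_3)
  next
    case 5
    show ?thesis
      unfolding imat_commutator_def imat_mult_jacobi imat_mult_lower_jacobi
      using 5 by  (simp add: lower_part_def jacobi_def zero)
  next
    case 6
    show ?thesis
      unfolding imat_commutator_def imat_mult_jacobi imat_mult_lower_jacobi
      using 6 by  (simp add: lower_part_def jacobi_def zero)
  next
    case 7
    then obtain k where "i = j + 5 + k"
      using le_Suc_ex by blast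
    then show ?thesis
      by (simp add: imat_commutator_def imat_mult_jacobi imat_mult_lower_jacobi
           lower_part_def jacobi_def zero)
  qed
qed

lemma toda_iff_lax: "toda_system a b c \<longleftrightarrow> lax_equation a b c"
proof
  assume toda: "toda_system a b c"
  have "((\<lambda>s. J s i j) has_vector_derivative imat_commutator (J t) (L t) i j) (at t)" for t i j
  proof -
    have abc: "(a (j + 1) has_vector_derivative b (j + 1) t - b j t) (at t)"
      "(b (j + 1) has_vector_derivative
         b (j + 1) t * (a (j + 2) t - a (j + 1) t) + c (j + 1) t - c j t) (at t)"
      "(c (j + 1) has_vector_derivative c (j + 1) t * (a (j + 3) t - a (j + 1) t)) (at t)"
      using toda[unfolded toda_system_def, rule_format, of "j + 1" t] by (simp_all add: numeral_3_eq_3)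
    consider "i = j" | "i = j + 1" | "i = j + 2" | "i < j \<or> j + 2 < i" by linarith
    then show ?thesis
    proof cases
      case 4
      then have "i \<noteq> j" "i \<noteq> j + 1" "i \<noteq> j + 2" by auto
      then show ?thesis by (simp add: commutator_jacobi jacobi_const[OF 4] del: One_nat_def)
    qed (use abc in \<open>simp_all add: commutator_jacobi jacobi_def\<close>)
  qed
  then show "lax_equation a b c" by (simp add: lax_equation_def)
next
  assume lax: "lax_equation a b c"
  have J: "((\<lambda>s. J s i j) has_vector_derivative imat_commutator (J t) (L t) i j) (at t)" for t i j
    using lax by (simp add: lax_equation_def)
  show "toda_system a b c"
    unfolding toda_system_def
  proof (intro allI impI)
    fix n :: nat and t :: real assume "1 \<le> n"
    then obtain j where n: "n = Suc j" by (cases n) auto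
    show "(a n has_vector_derivative b n t - b (n - 1) t) (at t) \<and>
       (b n has_vector_derivative b n t * (a (n + 1) t - a n t) + c n t - c (n - 1) t) (at t) \<and>
       (c n has_vector_derivative c n t * (a (n + 2) t - a n t)) (at t)"
      using J[of j j t] J[of "j + 1" j t] J[of "j + 2" j t]
      by (simp add: commutator_jacobi jacobi_def n numeral_3_eq_3)
  qed
qed

section \<open>The deviation from the Lax equation\<close>

definition J' :: "real \<Rightarrow> inf_matrix" where
  "J' t i j = vector_derivative (\<lambda>s. J s i j) (at t)"

lemma jacobi_has_vector_derivative: "((\<lambda>s. J s i j) has_vector_derivative J' t i j) (at t)"
proof -
  have "(\<lambda>s. J s i j) differentiable (at t)"
  proof -
    consider "i = j" | "i = j + 1" | "i = j + 2" | "i < j \<or> j + 2 < i" by linarith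
    then show ?thesis
    proof cases
      case 4
      show ?thesis by (simp add: jacobi_const[OF 4])
    qed (simp_all add: jacobi_def differentiable)
  qed
  then show ?thesis
    unfolding J'_def by (simp add: vector_derivative_works)
qed

lemma J'_zero: "i < j \<or> j + 2 < i \<Longrightarrow> J' t i j = 0"
  by (simp add: J'_def jacobi_const)

definition E :: "real \<Rightarrow> inf_matrix" where
  "E t i j = J' t i j - imat_commutator (J t) (L t) i j"

lemma E_zero: "i < j \<or> j + 2 < i \<Longrightarrow> E t i j = 0"
  unfolding E_def commutator_jacobi by (auto simp: J'_zero)

lemma lax_iff_E: "lax_equation a b c \<longleftrightarrow> (\<forall>t i j. E t i j = 0)"
proof -
  have "((\<lambda>s. J s i j) has_vector_derivative X) (at t) \<longleftrightarrow> J' t i j = X" for X t i j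
    using jacobi_has_vector_derivative[of i j t] vector_derivative_unique_at by blast
  then show ?thesis by (simp add: lax_equation_def E_def)
qed

lemma upper_band_J': "upper_band 1 (J' t)" and upper_band_E: "upper_band 0 (E t)"
  by (auto simp: upper_band_def J'_zero E_zero)

abbreviation "defect t \<equiv> power_defect (J t) (J' t) (L t)"

lemma power_has_vector_derivative:
  "((\<lambda>s. imat_power (J s) n i j) has_vector_derivative
     imat_commutator (imat_power (J t) n) (L t) i j + defect t n i j) (at t)"
  using has_vector_derivative_imat_power[OF upper_band_jacobi upper_band_J' jacobi_has_vector_derivative]
  by (simp add: power_defect_def)

lemma defect_0: "defect t 0 i j = 0"
  by (rule power_defect_0[OF upper_band_lower_part])

text \<open>\<open>E\<close> is lower triangular, and right of the diagonal row \<open>i\<close> of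
  \<open>J\<close> has only the 1 in column \<open>i + 1\<close>. Splitting it off shows how row
  \<open>i + 1\<close> of one defect passes, with coefficient 1, to row \<open>i\<close> of the
  next.\<close>

lemma defect_Suc:
  "defect t (Suc n) i j = (\<Sum>k\<le>i. E t i k * imat_power (J t) n k j)
     + (\<Sum>k\<le>i. J t i k * defect t n k j) + defect t n (Suc i) j"
proof -
  have *: "(\<lambda>i j. J' t i j - imat_commutator (J t) (L t) i j) = E t"
    by (intro ext) (simp add: E_def)
  have "imat_mult (J t) (defect t n) i j = (\<Sum>k<i+2. J t i k * defect t n k j)"
    by (rule imat_mult_sum[OF upper_band_jacobi]) simp
  moreover have "imat_mult (E t) (imat_power (J t) n) i j = (\<Sum>k<i+1. E t i k * imat_power (J t) n k j)"
    by (rule imat_mult_sum[OF upper_band_E]) simp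
  moreover have "J t i (Suc i) = 1" by (simp add: jacobi_def)
  ultimately show ?thesis
    using power_defect_Suc[OF upper_band_jacobi upper_band_J' upper_band_lower_part, of t t "J t" n i j]
    by (simp add: * lessThan_Suc_atMost)
qed

section \<open>Recovery of \<open>E\<close> from the leading blocks\<close>

lemma power_lower_zero: "j + 2 * n < i \<Longrightarrow> imat_power (J t) n i j = 0"
proof (induction n arbitrary: i)
  case 0
  then show ?case by (simp add: imat_one_def)
next
  case (Suc n)
  then show ?case unfolding imat_power.simps imat_mult_jacobi by auto
qed

text \<open>One factor \<open>J\<close> descends at most two rows, and two rows only through an
  entry of \<open>c\<close>; the extreme entry is the product of \<open>c (j + 2 * k + 1) t\<close>
  over \<open>k < n\<close>.\<close>

lemma power_lower_edge: "imat_power (J t) n (j + 2 * n) j \<noteq> 0"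
proof (induction n)
  case 0
  then show ?case by (simp add: imat_one_def)
next
  case (Suc n)
  then show ?case unfolding imat_power.simps imat_mult_jacobi
    using nonzero by (auto simp: power_lower_zero)
qed

text \<open>Everything here concerns column \<open>q\<close>: \<open>j\<^sub>0\<close> is the lowest
  row in which the \<open>m\<close>-th power of \<open>J\<close> is nonzero in that column, and
  \<open>(i\<^sub>0, j\<^sub>0)\<close> is the first position in row-major order where
  \<open>E t\<close> may be nonzero.\<close>

context
  fixes t i\<^sub>0 j\<^sub>0 q m
  assumes lex: "\<And>i j. i < i\<^sub>0 \<or> i = i\<^sub>0 \<and> j < j\<^sub>0 \<Longrightarrow> E t i j = 0"
    and j\<^sub>0: "j\<^sub>0 = q + 2 * m" "j\<^sub>0 \<le> i\<^sub>0"
begin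

lemma E_mult_power_edge:
  assumes "p + n \<le> i\<^sub>0 + m"
  shows "(\<Sum>k\<le>p. E t p k * imat_power (J t) n k q) =
    (if p = i\<^sub>0 \<and> n = m then E t i\<^sub>0 j\<^sub>0 * imat_power (J t) m j\<^sub>0 q else 0)"
proof -
  have zero: "E t p k * imat_power (J t) n k q = 0" if "\<not> (p = i\<^sub>0 \<and> n = m \<and> k = j\<^sub>0)" for k
  proof (rule ccontr)
    assume "E t p k * imat_power (J t) n k q \<noteq> 0"
    then have nz: "E t p k \<noteq> 0" "imat_power (J t) n k q \<noteq> 0" by auto
    have "k \<le> q + 2 * n" using power_lower_zero nz(2) by (meson not_le_imp_less)
    moreover have "k \<le> p" "p \<le> k + 2" using E_zero nz(1) by (meson not_le_imp_less)+
    moreover have "\<not> (p < i\<^sub>0 \<or> p = i\<^sub>0 \<and> k < j\<^sub>0)" using lex nz(1) by blast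
    \<comment> \<open>If \<open>d = p - i\<^sub>0 > 0\<close>, then \<open>n \<le> m - d\<close>
      gives \<open>k \<le> j\<^sub>0 - 2 * d\<close>, so
      \<open>p \<le> k + 2 \<le> i\<^sub>0 + 2 - 2 * d\<close>, against
      \<open>p = i\<^sub>0 + d\<close>. If \<open>p = i\<^sub>0\<close>, then
      \<open>j\<^sub>0 \<le> k \<le> q + 2 * n\<close> and \<open>n \<le> m\<close> force
      equality.\<close>
    ultimately show False using that assms j\<^sub>0 by linarith
  qed
  show ?thesis
  proof (cases "p = i\<^sub>0 \<and> n = m")
    case True
    then have "(\<Sum>k\<le>p. E t p k * imat_power (J t) n k q) =
      (\<Sum>k\<in>{j\<^sub>0}. E t p k * imat_power (J t) n k q)"
      by (intro sum.mono_neutral_right) (use zero j\<^sub>0 in auto)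
    then show ?thesis using True by simp
  next
    case False
    then have "(\<Sum>k\<le>p. E t p k * imat_power (J t) n k q) = 0"
      by (intro sum.neutral ballI zero) blast
    then show ?thesis unfolding if_not_P[OF False] .
  qed
qed

text \<open>The recursion for \<open>Suc n\<close> uses rows up to \<open>p + 1\<close> of defect
  \<open>n\<close>, which satisfy the same bound; the source from \<open>E\<close> needs
  \<open>p = i\<^sub>0\<close> and \<open>n = m\<close>, so it first appears one step beyond the
  bound.\<close>

lemma defect_below_edge: "p + n \<le> i\<^sub>0 + m \<Longrightarrow> defect t n p q = 0"
proof (induction n arbitrary: p)
  case (Suc n)
  have "(\<Sum>k\<le>p. J t p k * defect t n k q) = 0"
    by (rule sum.neutral) (use Suc in auto)
  then show ?case
    using Suc by (auto simp: defect_Suc E_mult_power_edge)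
qed (simp add: defect_0)

text \<open>The source arises in row \<open>i\<^sub>0\<close> at power \<open>m + 1\<close>. Each
  further power moves it up one row with coefficient 1, while the sum over \<open>k \<le> p\<close>
  consists of terms below the edge.\<close>

lemma defect_edge:
  "p + n = Suc (i\<^sub>0 + m) \<Longrightarrow>
    defect t n p q = (if p \<le> i\<^sub>0 then E t i\<^sub>0 j\<^sub>0 * imat_power (J t) m j\<^sub>0 q else 0)"
proof (induction n arbitrary: p)
  case (Suc n)
  have "(\<Sum>k\<le>p. J t p k * defect t n k q) = 0"
    by (rule sum.neutral) (use Suc.prems defect_below_edge in auto)
  moreover have "p = i\<^sub>0 \<longleftrightarrow> n = m" using Suc.prems by auto
  ultimately show ?case
    using Suc.prems Suc.IH[of "Suc p"] by (auto simp: defect_Suc E_mult_power_edge)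
qed (simp add: defect_0)

end

lemma E_eq_0_iff_defect: "(\<forall>i j. E t i j = 0) \<longleftrightarrow> (\<forall>n. \<forall>p<2. \<forall>q<2. defect t n p q = 0)"
proof
  assume E: "\<forall>i j. E t i j = 0"
  have "defect t n p q = 0" for n p q
    by (induction n arbitrary: p) (simp_all add: defect_0 defect_Suc E)
  then show "\<forall>n. \<forall>p<2. \<forall>q<2. defect t n p q = 0" by simp
next
  assume D: "\<forall>n. \<forall>p<2. \<forall>q<2. defect t n p q = 0"
  have "\<forall>j. E t i j = 0" for i
  proof (induction i rule: less_induct)
    case (less i)
    show ?case
    proof
      fix j show "E t i j = 0"
      proof (induction j rule: less_induct)
        case (less j)
        show ?case
        proof (cases "j \<le> i")
          case True
          \<comment> \<open>The power is chosen so that row 0 lies on the edge; column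
            \<open>j mod 2\<close> is in the leading block, where \<open>D\<close> applies.\<close>
          have "defect t (Suc (i + j div 2)) 0 (j mod 2) =
            (if 0 \<le> i then E t i j * imat_power (J t) (j div 2) j (j mod 2) else 0)"
          proof (rule defect_edge)
            show "E t i' j' = 0" if "i' < i \<or> i' = i \<and> j' < j" for i' j'
              using that less.IH \<open>\<And>y. y < i \<Longrightarrow> \<forall>j. E t y j = 0\<close> by blast
          qed (use True in auto)
          moreover have "imat_power (J t) (j div 2) j (j mod 2) \<noteq> 0"
            using power_lower_edge[of t "j div 2" "j mod 2"] by simp
          ultimately show ?thesis using D by simp
        qed (simp add: E_zero)
      qed
    qed
  qed
  then show "\<forall>i j. E t i j = 0" by blast
qed

lemma toda_iff_power_derivative:
  "toda_system a b c \<longleftrightarrow> (\<forall>t n. \<forall>p<2. \<forall>q<2.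
     ((\<lambda>s. imat_power (J s) n p q) has_vector_derivative
       imat_commutator (imat_power (J t) n) (L t) p q) (at t))"
proof -
  have "((\<lambda>s. imat_power (J s) n p q) has_vector_derivative
       imat_commutator (imat_power (J t) n) (L t) p q) (at t) \<longleftrightarrow> defect t n p q = 0" for t n p q
    using power_has_vector_derivative[of n p q t]
    by (metis add.right_neutral add_left_cancel vector_derivative_unique_at)
  then show ?thesis
    by (simp add: toda_iff_lax lax_iff_E E_eq_0_iff_defect)
qed

lemma commutator_power:
  "imat_commutator (imat_power (J t) n) (L t) i j =
    imat_power (J t) (Suc n) i j - (\<Sum>k\<le>j. imat_power (J t) n i k * J t k j)
      - (\<Sum>k<i. J t i k * imat_power (J t) n k j)"
  using imat_commutator_lower_part[OF upper_band_imat_power[OF upper_band_jacobi], of "J t" t n]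
    imat_power_Suc_right[OF upper_band_jacobi, of t n] by simp

end

section \<open>Operators on \<open>ell2\<close> and the Neumann series\<close>

lemma ell2_norm_nonneg: "x \<in> ell2 \<Longrightarrow> 0 \<le> ell2_norm x"
  by (simp add: ell2_norm_def ell2_def suminf_nonneg)

lemma L2_set_le_ell2_norm:
  assumes "x \<in> ell2" "finite N"
  shows "L2_set (\<lambda>n. cmod (x n)) N \<le> ell2_norm x"
  unfolding L2_set_def ell2_norm_def
  using assms by (auto simp: ell2_def intro!: real_sqrt_le_mono sum_le_suminf)

text \<open>Finite sections determine both membership and norm, so limits can be handled with finite
  sums.\<close>

lemma ell2I:
  assumes "\<And>N. L2_set (\<lambda>n. cmod (x n)) {..<N} \<le> C"
  shows "x \<in> ell2" "ell2_norm x \<le> C"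
proof -
  have C: "0 \<le> C" using assms[of 0] by simp
  have le: "(\<Sum>n<N. (cmod (x n))\<^sup>2) \<le> C\<^sup>2" for N
    using assms[of N] unfolding L2_set_def by (simp add: sqrt_le_D)
  have S: "summable (\<lambda>n. (cmod (x n))\<^sup>2)"
    by (rule summableI_nonneg_bounded[OF _ le]) simp
  then show "x \<in> ell2" by (simp add: ell2_def)
  have "(\<Sum>n. (cmod (x n))\<^sup>2) \<le> C\<^sup>2"
    by (rule suminf_le_const[OF S le])
  then show "ell2_norm x \<le> C"
    unfolding ell2_norm_def using C by (simp add: real_le_lsqrt)
qed

lemma cmod_le_ell2_norm: "x \<in> ell2 \<Longrightarrow> cmod (x i) \<le> ell2_norm x"
  using L2_set_le_ell2_norm[of x "{i}"] by simp

lemma ell2_add: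
  assumes "x \<in> ell2" "y \<in> ell2"
  shows "(\<lambda>i. x i + y i) \<in> ell2" "ell2_norm (\<lambda>i. x i + y i) \<le> ell2_norm x + ell2_norm y"
proof -
  have "L2_set (\<lambda>n. cmod (x n + y n)) {..<N} \<le> ell2_norm x + ell2_norm y" for N
  proof -
    have "L2_set (\<lambda>n. cmod (x n + y n)) {..<N} \<le> L2_set (\<lambda>n. cmod (x n) + cmod (y n)) {..<N}"
      by (intro L2_set_mono norm_triangle_ineq) auto
    also have "\<dots> \<le> L2_set (\<lambda>n. cmod (x n)) {..<N} + L2_set (\<lambda>n. cmod (y n)) {..<N}"
      by (rule L2_set_triangle_ineq)
    also have "\<dots> \<le> ell2_norm x + ell2_norm y"
      by (intro add_mono L2_set_le_ell2_norm assms) auto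
    finally show ?thesis .
  qed
  from ell2I[OF this] show "(\<lambda>i. x i + y i) \<in> ell2"
    "ell2_norm (\<lambda>i. x i + y i) \<le> ell2_norm x + ell2_norm y" .
qed

lemma ell2_scale:
  assumes "x \<in> ell2"
  shows "(\<lambda>i. k * x i) \<in> ell2" "ell2_norm (\<lambda>i. k * x i) = cmod k * ell2_norm x"
  using assms
  by (auto simp: ell2_def ell2_norm_def norm_mult power_mult_distrib summable_mult suminf_mult
       real_sqrt_mult)

lemma ell2_zero: "(\<lambda>i. 0) \<in> ell2" "ell2_norm (\<lambda>i. 0) = 0"
  by (simp_all add: ell2_def ell2_norm_def)

lemma ell2_unit:
  "(\<lambda>i. if i = j then 1 else 0) \<in> ell2" "ell2_norm (\<lambda>i. if i = j then 1 else 0) = 1"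
proof -
  have "(\<lambda>n. (cmod (if n = j then 1 else 0))\<^sup>2) sums (\<Sum>n\<in>{j}. (cmod (if n = j then 1 else 0))\<^sup>2)"
    by (rule sums_finite) auto
  then show "(\<lambda>i. if i = j then 1 else 0) \<in> ell2" "ell2_norm (\<lambda>i. if i = j then 1 else 0) = 1"
    by (simp_all add: ell2_def ell2_norm_def sums_iff)
qed

lemma imat_apply_sum:
  assumes "upper_band p M" "i + p < n"
  shows "imat_apply M x i = (\<Sum>k<n. M i k * x k)"
  unfolding imat_apply_def
  by (rule suminf_finite) (use assms in \<open>auto simp: upper_band_def\<close>)

text \<open>The supremum in \<open>imat_norm\<close> is meaningful only if images stay in
  \<open>ell2\<close> and the set is bounded; this predicate records both, for any bound
  \<open>C\<close> and not only the least.\<close>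

definition ell2_bounded :: "inf_matrix \<Rightarrow> real \<Rightarrow> bool" where
  "ell2_bounded M C \<longleftrightarrow>
     (\<forall>x\<in>ell2. imat_apply M x \<in> ell2 \<and> ell2_norm (imat_apply M x) \<le> C * ell2_norm x)"

text \<open>Any bound \<open>C\<close> makes the supremum genuine, and homogeneity reduces to the
  unit ball. A vector of norm 0 cannot be rescaled and is treated with \<open>C\<close>
  directly.\<close>

lemma ell2_bounded_imat_norm:
  assumes M: "upper_band p M" and C: "ell2_bounded M C"
  shows "ell2_bounded M (imat_norm M)"
  unfolding ell2_bounded_def
proof (intro ballI conjI)
  let ?S = "{x \<in> ell2. ell2_norm x \<le> 1}"
  fix x assume x: "x \<in> ell2"
  then show "imat_apply M x \<in> ell2" using C by (simp add: ell2_bounded_def)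
  have bdd: "bdd_above ((\<lambda>x. ell2_norm (imat_apply M x)) ` ?S)"
  proof (rule bdd_aboveI2)
    fix y assume y: "y \<in> ?S"
    then have "ell2_norm (imat_apply M y) \<le> C * ell2_norm y" using C by (simp add: ell2_bounded_def)
    also have "\<dots> \<le> \<bar>C\<bar> * 1" using y by (intro mult_mono) (auto simp: ell2_norm_nonneg)
    finally show "ell2_norm (imat_apply M y) \<le> \<bar>C\<bar> * 1" .
  qed
  show "ell2_norm (imat_apply M x) \<le> imat_norm M * ell2_norm x"
  proof (cases "ell2_norm x = 0")
    case True
    then have "ell2_norm (imat_apply M x) \<le> 0"
      using C x by (auto simp: ell2_bounded_def)
    then show ?thesis using True by simp
  next
    case False
    define k where "k = inverse (ell2_norm x)"
    have k: "k > 0" using False ell2_norm_nonneg[OF x] by (simp add: k_def)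
    define y where "y = (\<lambda>i. complex_of_real k * x i)"
    have y: "y \<in> ?S" using x k False by (simp add: y_def ell2_scale) (simp add: k_def)
    have "imat_apply M y = (\<lambda>i. complex_of_real k * imat_apply M x i)"
      by (intro ext) (simp add: imat_apply_sum[OF M lessI] y_def sum_distrib_left mult_ac del: sum.lessThan_Suc)
    then have "k * ell2_norm (imat_apply M x) = ell2_norm (imat_apply M y)"
      using C x k by (simp add: ell2_bounded_def ell2_scale)
    also have "\<dots> \<le> imat_norm M"
      unfolding imat_norm_def by (rule cSUP_upper[OF y bdd])
    finally show ?thesis
      using k by (simp add: k_def field_simps)
  qed
qed

lemma imat_norm_nonneg:
  assumes "upper_band p M" "ell2_bounded M C"
  shows "0 \<le> imat_norm M"
proof -
  let ?e = "\<lambda>i. if i = (0::nat) then 1 else (0::complex)"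
  have "imat_apply M ?e \<in> ell2 \<and> ell2_norm (imat_apply M ?e) \<le> imat_norm M * ell2_norm ?e"
    using ell2_bounded_imat_norm[OF assms] ell2_unit(1)[of 0] unfolding ell2_bounded_def by blast
  then show ?thesis
    using ell2_norm_nonneg[of "imat_apply M ?e"] by (simp add: ell2_unit)
qed

lemma imat_norm_le:
  assumes "ell2_bounded M C" "0 \<le> C"
  shows "imat_norm M \<le> C"
  unfolding imat_norm_def
proof (rule cSUP_least)
  show "{x \<in> ell2. ell2_norm x \<le> 1} \<noteq> {}" using ell2_zero by force
  fix x assume x: "x \<in> {x \<in> ell2. ell2_norm x \<le> 1}"
  then have "ell2_norm (imat_apply M x) \<le> C * ell2_norm x"
    using assms by (simp add: ell2_bounded_def)
  also have "\<dots> \<le> C" using x assms by (simp add: mult_left_le)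
  finally show "ell2_norm (imat_apply M x) \<le> C" .
qed

lemma ell2_bounded_add:
  assumes "upper_band p M" "upper_band q N" "ell2_bounded M C" "ell2_bounded N D"
  shows "ell2_bounded (\<lambda>i j. M i j + N i j) (C + D)"
  unfolding ell2_bounded_def
proof
  fix x assume x: "x \<in> ell2"
  have "upper_band (p + q) (\<lambda>i j. M i j + N i j)"
    using assms by (simp add: upper_band_def)
  then have "imat_apply (\<lambda>i j. M i j + N i j) x i = imat_apply M x i + imat_apply N x i" for i
    by (simp add: imat_apply_sum[OF assms(1), of i "i+p+q+1"] imat_apply_sum[OF assms(2), of i "i+p+q+1"]
       imat_apply_sum[of "p+q" _ i "i+p+q+1"] distrib_right sum.distrib)
  then have *: "imat_apply (\<lambda>i j. M i j + N i j) x = (\<lambda>i. imat_apply M x i + imat_apply N x i)" ..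
  show "imat_apply (\<lambda>i j. M i j + N i j) x \<in> ell2 \<and>
      ell2_norm (imat_apply (\<lambda>i j. M i j + N i j) x) \<le> (C + D) * ell2_norm x"
    using assms x ell2_add[of "imat_apply M x" "imat_apply N x"] unfolding *
    by (fastforce simp: ell2_bounded_def distrib_right)
qed

lemma imat_norm_perturbation:
  assumes M: "upper_band p M" "ell2_bounded M C"
    and N: "upper_band q N" and D: "ell2_bounded (\<lambda>i j. N i j - M i j) D" "0 \<le> D"
  shows "imat_norm N \<le> imat_norm M + D"
proof -
  have "upper_band (p + q) (\<lambda>i j. N i j - M i j)"
    using M N by (simp add: upper_band_def)
  from ell2_bounded_add[OF M(1) this ell2_bounded_imat_norm[OF M] D(1)]
  have "ell2_bounded N (imat_norm M + D)" by simp
  then show ?thesis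
    using D(2) imat_norm_nonneg[OF M] by (intro imat_norm_le) auto
qed

section \<open>Neumann series for the inverse\<close>

lemma imat_power_column_ell2:
  assumes "ell2_bounded M r" "0 \<le> r"
  shows "(\<lambda>i. imat_power M n i j) \<in> ell2" "ell2_norm (\<lambda>i. imat_power M n i j) \<le> r ^ n"
proof (induction n)
  case 0
  show "(\<lambda>i. imat_power M 0 i j) \<in> ell2" "ell2_norm (\<lambda>i. imat_power M 0 i j) \<le> r ^ 0"
    using ell2_unit[of j] by (simp_all add: imat_one_def)
next
  case (Suc n)
  have *: "(\<lambda>i. imat_power M (Suc n) i j) = imat_apply M (\<lambda>i. imat_power M n i j)"
    by (simp add: imat_mult_def imat_apply_def fun_eq_iff)
  show "(\<lambda>i. imat_power M (Suc n) i j) \<in> ell2"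
    unfolding * using assms Suc by (simp add: ell2_bounded_def)
  have "ell2_norm (imat_apply M (\<lambda>i. imat_power M n i j)) \<le> r * ell2_norm (\<lambda>i. imat_power M n i j)"
    using assms Suc by (simp add: ell2_bounded_def)
  also have "\<dots> \<le> r * r ^ n" using Suc assms by (intro mult_left_mono)
  finally show "ell2_norm (\<lambda>i. imat_power M (Suc n) i j) \<le> r ^ Suc n"
    unfolding * by simp
qed

lemma cmod_imat_power_le:
  assumes "ell2_bounded M r" "0 \<le> r"
  shows "cmod (imat_power M n i j) \<le> r ^ n"
  using cmod_le_ell2_norm[OF imat_power_column_ell2(1)[OF assms, of n j], of i]
    imat_power_column_ell2(2)[OF assms, of n j] by (rule order_trans)

lemma ell2_neumann_partial_sum:
  assumes M: "ell2_bounded M r" "0 \<le> r"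
  shows "(\<lambda>i. \<Sum>n<m. imat_power M n i j / z ^ Suc n) \<in> ell2"
    "ell2_norm (\<lambda>i. \<Sum>n<m. imat_power M n i j / z ^ Suc n) \<le> (\<Sum>n<m. r ^ n / cmod z ^ Suc n)"
proof (induction m)
  case 0
  show "(\<lambda>i. \<Sum>n<0. imat_power M n i j / z ^ Suc n) \<in> ell2"
    "ell2_norm (\<lambda>i. \<Sum>n<0. imat_power M n i j / z ^ Suc n) \<le> (\<Sum>n<0. r ^ n / cmod z ^ Suc n)"
    by (simp_all add: ell2_zero)
next
  case (Suc m)
  let ?S = "\<lambda>m i. \<Sum>n<m. imat_power M n i j / z ^ Suc n"
  let ?t = "\<lambda>i. inverse (z ^ Suc m) * imat_power M m i j"
  note col = imat_power_column_ell2[OF M, of m j]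
  have *: "?S (Suc m) = (\<lambda>i. ?S m i + ?t i)" by (simp add: divide_inverse mult.commute)
  have t: "?t \<in> ell2" by (rule ell2_scale(1)[OF col(1)])
  show "?S (Suc m) \<in> ell2" unfolding * by (rule ell2_add(1)[OF Suc(1) t])
  have "ell2_norm (?S (Suc m)) \<le> ell2_norm (?S m) + ell2_norm ?t"
    unfolding * by (rule ell2_add(2)[OF Suc(1) t])
  also have "ell2_norm ?t \<le> r ^ m / cmod z ^ Suc m"
    unfolding ell2_scale(2)[OF col(1)] norm_inverse norm_power
    using divide_right_mono[OF col(2), of "cmod z ^ Suc m"]
    by (simp add: divide_inverse mult.commute del: power_Suc)
  finally show "ell2_norm (?S (Suc m)) \<le> (\<Sum>n<Suc m. r ^ n / cmod z ^ Suc n)"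
    using Suc(2) by simp
qed

lemma summable_neumann_bound:
  fixes r :: real
  assumes "0 \<le> r" "r < R"
  shows "summable (\<lambda>n. r ^ n / R ^ Suc n)"
proof -
  have "summable (\<lambda>n. inverse R * (r / R) ^ n)"
    using assms by (intro summable_mult summable_geometric) auto
  then show ?thesis by (simp add: power_divide field_simps)
qed

lemma summable_neumann:
  assumes M: "ell2_bounded M r" "0 \<le> r" and z: "r < cmod z"
  shows "summable (\<lambda>n. imat_power M n i j / z ^ Suc n)"
proof (rule summable_comparison_test'[OF summable_neumann_bound[OF M(2) z]])
  show "norm (imat_power M n i j / z ^ Suc n) \<le> r ^ n / cmod z ^ Suc n" for n
    unfolding norm_divide norm_power by (intro divide_right_mono cmod_imat_power_le M) auto
qed

text \<open>The entries converge one by one, and for fixed \<open>N\<close> the norm of the first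
  \<open>N\<close> entries is continuous in them; so the bound \<open>C\<close>, uniform in
  \<open>m\<close> and \<open>N\<close>, passes to the limit.\<close>

lemma neumann_column_ell2:
  assumes M: "ell2_bounded M r" "0 \<le> r" and z: "r < cmod z"
  shows "(\<lambda>i. \<Sum>n. imat_power M n i j / z ^ Suc n) \<in> ell2"
proof (rule ell2I(1))
  fix N
  define C where "C = (\<Sum>n. r ^ n / cmod z ^ Suc n)"
  let ?S = "\<lambda>m i. \<Sum>n<m. imat_power M n i j / z ^ Suc n"
  have "L2_set (\<lambda>i. cmod (?S m i)) {..<N} \<le> C" for m
  proof -
    have "L2_set (\<lambda>i. cmod (?S m i)) {..<N} \<le> ell2_norm (?S m)"
      by (intro L2_set_le_ell2_norm ell2_neumann_partial_sum[OF M]) auto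
    also have "\<dots> \<le> (\<Sum>n<m. r ^ n / cmod z ^ Suc n)"
      by (rule ell2_neumann_partial_sum[OF M])
    also have "\<dots> \<le> C"
      unfolding C_def using M by (intro sum_le_suminf summable_neumann_bound M z) auto
    finally show ?thesis .
  qed
  moreover have "(\<lambda>m. L2_set (\<lambda>i. cmod (?S m i)) {..<N}) \<longlonglongrightarrow>
      L2_set (\<lambda>i. cmod (\<Sum>n. imat_power M n i j / z ^ Suc n)) {..<N}"
    unfolding L2_set_def by (intro tendsto_intros summable_LIMSEQ summable_neumann[OF M z])
  ultimately show "L2_set (\<lambda>i. cmod (\<Sum>n. imat_power M n i j / z ^ Suc n)) {..<N} \<le> C"
    by (intro LIMSEQ_le_const2) auto
qed

lemma imat_apply_shift:
  assumes "upper_band p M"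
  shows "imat_apply (\<lambda>i j. z * imat_one i j - M i j) x i = z * x i - imat_apply M x i"
proof -
  have band: "upper_band p (\<lambda>i j. z * imat_one i j - M i j)"
    using assms by (auto simp: upper_band_def imat_one_def)
  have "(\<Sum>k<Suc (i + p). z * imat_one i k * x k) = (\<Sum>k<Suc (i + p). if k = i then z * x i else 0)"
    by (intro sum.cong) (auto simp: imat_one_def)
  also have "\<dots> = z * x i" by simp
  finally show ?thesis
    unfolding imat_apply_sum[OF assms lessI] imat_apply_sum[OF band lessI]
    by (simp only: left_diff_distrib sum_subtractf)
qed

text \<open>\<open>inv_into\<close> returns the Neumann column because that column is a preimage in
  \<open>ell2\<close> and the shifted operator is injective there: \<open>M y = z y\<close> gives
  \<open>cmod z * ell2_norm y \<le> r * ell2_norm y\<close>.\<close>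

lemma imat_inverse_neumann:
  assumes band: "upper_band p M" and M: "ell2_bounded M r" "0 \<le> r" and z: "r < cmod z"
  shows "imat_inverse (\<lambda>i j. z * imat_one i j - M i j) i j = (\<Sum>n. imat_power M n i j / z ^ Suc n)"
proof -
  define T where "T = imat_apply (\<lambda>i j. z * imat_one i j - M i j)"
  define x where "x = (\<lambda>i. \<Sum>n. imat_power M n i j / z ^ Suc n)"
  have T: "T y i = z * y i - imat_apply M y i" for y i
    unfolding T_def by (rule imat_apply_shift[OF band])
  have "inj_on T ell2"
  proof (rule inj_onI)
    fix u v assume u: "u \<in> ell2" and v: "v \<in> ell2" and eq: "T u = T v"
    define y where "y = (\<lambda>i. u i + (-1) * v i)"
    have y: "y \<in> ell2" unfolding y_def by (intro ell2_add ell2_scale u v)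
    have "imat_apply M y = (\<lambda>i. z * y i)"
    proof
      fix i
      have "imat_apply M y i = imat_apply M u i - imat_apply M v i"
        by (simp add: imat_apply_sum[OF band lessI] y_def right_diff_distrib sum_subtractf
             del: sum.lessThan_Suc)
      also have "\<dots> = z * y i"
        using fun_cong[OF eq, of i] by (simp add: T y_def algebra_simps)
      finally show "imat_apply M y i = z * y i" .
    qed
    then have "cmod z * ell2_norm y \<le> r * ell2_norm y"
      using M y by (metis ell2_bounded_def ell2_scale(2))
    then have "ell2_norm y \<le> 0"
      using z ell2_norm_nonneg[OF y] by (simp add: mult_le_cancel_right)
    then have "y i = 0" for i
      using order_trans[OF cmod_le_ell2_norm[OF y, of i] \<open>ell2_norm y \<le> 0\<close>] by simp
    then show "u = v" by (auto simp: y_def)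
  qed
  moreover have "x \<in> ell2"
    unfolding x_def by (rule neumann_column_ell2[OF M z])
  moreover have "T x = (\<lambda>k. if k = j then 1 else 0)"
  proof
    fix i
    let ?f = "\<lambda>n. imat_power M n i j / z ^ n"
    have z0: "z \<noteq> 0" using z M(2) by auto
    have f: "z * (imat_power M n i j / z ^ Suc n) = ?f n" for n using z0 by simp
    note summable_mult[OF summable_neumann[OF M z, of i j], of z]
    then have sf: "summable ?f" unfolding f .
    \<comment> \<open>A row of \<open>M\<close> is finite, so \<open>M\<close> acts term by term; it
      raises the power, and the series telescopes against \<open>z * x i\<close>.\<close>
    have "imat_apply M x i = (\<Sum>n. \<Sum>k<Suc (i + p). M i k * (imat_power M n k j / z ^ Suc n))"
      unfolding imat_apply_sum[OF band lessI] x_def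
      by (simp only: suminf_mult[symmetric, OF summable_neumann[OF M z]])
         (intro suminf_sum[symmetric] summable_mult summable_neumann[OF M z])
    also have "\<dots> = (\<Sum>n. ?f (Suc n))"
      by (simp only: imat_power.simps imat_mult_sum[OF band lessI] sum_divide_distrib times_divide_eq_right)
    also have "\<dots> = (\<Sum>n. ?f n) - ?f 0"
      by (rule suminf_split_head[OF sf])
    also have "(\<Sum>n. ?f n) = z * x i"
      unfolding x_def by (simp only: suminf_mult[symmetric, OF summable_neumann[OF M z]] f)
    finally show "T x i = (if i = j then 1 else 0)"
      by (simp add: T imat_one_def)
  qed
  ultimately have "inv_into ell2 T (\<lambda>k. if k = j then 1 else 0) = x"
    by (metis inv_into_f_f)
  then show ?thesis
    unfolding imat_inverse_def T_def x_def by metis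
qed

lemma ell2_bounded_mono:
  assumes "ell2_bounded M C" "C \<le> D"
  shows "ell2_bounded M D"
  using assms ell2_norm_nonneg unfolding ell2_bounded_def
  by (meson mult_right_mono order_trans)

text \<open>Four diagonals, each a shift of norm at most 1 with weights bounded by
  \<open>K\<close>.\<close>

lemma ell2_bounded_banded:
  assumes band: "\<And>i j. i + 1 < j \<or> j + 2 < i \<Longrightarrow> M i j = 0"
    and le: "\<And>i j. cmod (M i j) \<le> K"
  shows "ell2_bounded M (4 * K)"
  unfolding ell2_bounded_def
proof
  fix x assume x: "x \<in> ell2"
  have K: "0 \<le> K" using order_trans[OF norm_ge_zero le] .
  \<comment> \<open>The modulus of \<open>x\<close> shifted by \<open>d\<close> places and filled up
    with zeros; the guard keeps the truncated \<open>i - d\<close> from repeating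
    \<open>x 0\<close>.\<close>
  define s where "s = (\<lambda>d i. if d \<le> i then cmod (x (i - d)) else 0)"
  have pointwise: "cmod (imat_apply M x i) \<le> K * (cmod (x (Suc i)) + (s 0 i + (s 1 i + s 2 i)))" for i
  proof -
    have "upper_band 1 M" using band by (simp add: upper_band_def)
    then have "imat_apply M x i = (\<Sum>k<i+2. M i k * x k)"
      by (rule imat_apply_sum) simp
    then have "cmod (imat_apply M x i) \<le> (\<Sum>k<i+2. cmod (M i k) * cmod (x k))"
      by (simp add: norm_mult sum_norm_le del: sum.lessThan_Suc add_2_eq_Suc')
    also have "\<dots> \<le> (\<Sum>k<i+2. if i \<le> k + 2 then K * cmod (x k) else 0)"
      using band le by (intro sum_mono) (auto intro!: mult_right_mono)
    also have "\<dots> = K * (cmod (x (Suc i)) + (s 0 i + (s 1 i + s 2 i)))"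
    proof -
      consider "i = 0" | "i = 1" | m where "i = Suc (Suc m)"
        by (metis One_nat_def not0_implies_Suc)
      then show ?thesis
        by cases (simp_all add: s_def algebra_simps eval_nat_numeral)
    qed
    finally show ?thesis .
  qed
  have shift: "L2_set (s d) {..<N} \<le> ell2_norm x" for d N
  proof -
    have "(\<Sum>i<N. (s d i)\<^sup>2) = (\<Sum>i\<in>{d..<N}. (s d i)\<^sup>2)"
      by (rule sum.mono_neutral_right) (auto simp: s_def)
    also have "\<dots> = (\<Sum>i\<in>(\<lambda>i. i - d) ` {d..<N}. (cmod (x i))\<^sup>2)"
      by (subst sum.reindex) (auto simp: s_def inj_on_def intro!: sum.cong)
    finally have "L2_set (s d) {..<N} = L2_set (\<lambda>i. cmod (x i)) ((\<lambda>i. i - d) ` {d..<N})"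
      by (simp add: L2_set_def)
    then show ?thesis by (simp add: L2_set_le_ell2_norm[OF x])
  qed
  have shift': "L2_set (\<lambda>i. cmod (x (Suc i))) {..<N} \<le> ell2_norm x" for N
  proof -
    have "L2_set (\<lambda>i. cmod (x (Suc i))) {..<N} = L2_set (\<lambda>i. cmod (x i)) (Suc ` {..<N})"
      by (simp add: L2_set_def sum.reindex)
    then show ?thesis by (simp add: L2_set_le_ell2_norm[OF x])
  qed
  have "L2_set (\<lambda>n. cmod (imat_apply M x n)) {..<N} \<le> 4 * K * ell2_norm x" for N
  proof -
    have "L2_set (\<lambda>n. cmod (imat_apply M x n)) {..<N} \<le>
        L2_set (\<lambda>i. K * (cmod (x (Suc i)) + (s 0 i + (s 1 i + s 2 i)))) {..<N}"
      by (intro L2_set_mono pointwise) auto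
    also have "\<dots> = K * L2_set (\<lambda>i. cmod (x (Suc i)) + (s 0 i + (s 1 i + s 2 i))) {..<N}"
      by (rule L2_set_right_distrib[OF K, symmetric])
    also have "\<dots> \<le> K * (ell2_norm x + (ell2_norm x + (ell2_norm x + ell2_norm x)))"
      by (intro mult_left_mono K order_trans[OF L2_set_triangle_ineq] add_mono shift shift')
    finally show ?thesis by simp
  qed
  from ell2I[OF this] show "imat_apply M x \<in> ell2 \<and> ell2_norm (imat_apply M x) \<le> 4 * K * ell2_norm x"
    by simp
qed

section \<open>The resolvent\<close>

text \<open>The M-test makes the series of derivatives converge uniformly on \<open>S\<close>, which
  justifies termwise differentiation.\<close>

lemma has_vector_derivative_suminf:
  fixes f f' :: "nat \<Rightarrow> real \<Rightarrow> 'b::banach"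
  assumes S: "convex S" "x \<in> S"
    and deriv: "\<And>n y. y \<in> S \<Longrightarrow> (f n has_vector_derivative f' n y) (at y within S)"
    and bound: "\<And>n y. y \<in> S \<Longrightarrow> norm (f' n y) \<le> M n" "summable M"
    and sum: "\<And>y. y \<in> S \<Longrightarrow> summable (\<lambda>n. f n y)"
  shows "((\<lambda>y. \<Sum>n. f n y) has_vector_derivative (\<Sum>n. f' n x)) (at x within S)"
proof -
  have lim: "uniform_limit S (\<lambda>n y. \<Sum>i<n. f' i y) (\<lambda>y. \<Sum>i. f' i y) sequentially"
    using bound by (rule Weierstrass_m_test)
  have "\<exists>g. \<forall>y\<in>S. (\<lambda>n. f n y) sums g y \<and>
          (g has_derivative (\<lambda>h. h *\<^sub>R (\<Sum>i. f' i y))) (at y within S)"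
  proof (rule has_derivative_series[OF S(1) _ _ S(2)])
    show "(f n has_derivative (\<lambda>h. h *\<^sub>R f' n y)) (at y within S)" if "y \<in> S" for n y
      using deriv[OF that] by (simp add: has_vector_derivative_def)
    show "(\<lambda>n. f n x) sums (\<Sum>n. f n x)" using sum[OF S(2)] by (rule summable_sums)
    fix e :: real assume "e > 0"
    from uniform_limitD[OF lim this]
    show "\<forall>\<^sub>F n in sequentially. \<forall>y\<in>S. \<forall>h.
            norm ((\<Sum>i<n. h *\<^sub>R f' i y) - h *\<^sub>R (\<Sum>i. f' i y)) \<le> e * norm h"
    proof eventually_elim
      case (elim n)
      show ?case
      proof (intro ballI allI)
        fix y h assume "y \<in> S"
        then have "norm ((\<Sum>i<n. f' i y) - (\<Sum>i. f' i y)) \<le> e" using elim by (force simp: dist_norm)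
        then have "\<bar>h\<bar> * norm ((\<Sum>i<n. f' i y) - (\<Sum>i. f' i y)) \<le> \<bar>h\<bar> * e"
          by (intro mult_left_mono) auto
        then show "norm ((\<Sum>i<n. h *\<^sub>R f' i y) - h *\<^sub>R (\<Sum>i. f' i y)) \<le> e * norm h"
          by (simp only: scaleR_sum_right[symmetric] scaleR_diff_right[symmetric] norm_scaleR
            real_norm_def mult.commute)
      qed
    qed
  qed
  then obtain g where g: "\<And>y. y \<in> S \<Longrightarrow> (\<lambda>n. f n y) sums g y"
      "\<And>y. y \<in> S \<Longrightarrow> (g has_vector_derivative (\<Sum>i. f' i y)) (at y within S)"
    unfolding has_vector_derivative_def by blast
  show ?thesis
    by (rule has_vector_derivative_transform[OF S(2) _ g(2)[OF S(2)]]) (rule sums_unique[OF g(1), symmetric])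
qed

text \<open>Put \<open>w = 1 / z\<close>. Once the lower coefficients vanish, division by
  \<open>w ^ Suc n\<close> leaves a power series that is zero for all small
  \<open>w \<noteq> 0\<close>, and its limit at 0 is \<open>d n\<close>.\<close>

lemma sums_inverse_powers_eq_0:
  fixes d :: "nat \<Rightarrow> complex"
  assumes "\<And>z. \<rho> < cmod z \<Longrightarrow> (\<lambda>n. d n / z ^ Suc n) sums 0" "0 < \<rho>"
  shows "d n = 0"
proof (induction n rule: less_induct)
  case (less n)
  have "(\<lambda>k. d (k + n) * w ^ k) sums 0" if w: "w \<noteq> 0" "cmod w < 1 / \<rho>" for w
  proof -
    have "\<rho> < cmod (1 / w)" using w assms(2) by (simp add: norm_divide field_simps)
    from assms(1)[OF this] have "(\<lambda>k. d k * w ^ Suc k) sums 0"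
      by (simp add: power_divide)
    then have "(\<lambda>k. d (k + n) * w ^ Suc (k + n)) sums 0"
      using less by (subst sums_iff_shift) simp
    from sums_mult[OF this, of "inverse (w ^ Suc n)"] w(1) show ?thesis
      by (simp add: power_add field_simps)
  qed
  then have "((\<lambda>_. 0) \<longlongrightarrow> d (0 + n)) (at (0::complex))"
    using assms(2) by (intro powser_limit_0_strong[of "1 / \<rho>" "\<lambda>k. d (k + n)"]) auto
  then show ?case by (simp add: tendsto_const_iff)
qed

section \<open>The resolvent of \<open>J\<close> and its derivative in \<open>t\<close>\<close>

locale bounded_jacobi = jacobi_coefficients +
  fixes K :: real
  assumes K: "0 < K" "\<And>n t. n \<ge> 1 \<Longrightarrow> cmod (a n t) \<le> K" "\<And>n t. n \<ge> 1 \<Longrightarrow> cmod (b n t) \<le> K"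
    "\<And>n t. n \<ge> 1 \<Longrightarrow> cmod (c n t) \<le> K"
begin

lemma cmod_jacobi_le: "cmod (J t i j) \<le> K + 1"
  using K(1) K(2)[of "i + 1" t] K(3)[of "j + 1" t] K(4)[of "j + 1" t] by (auto simp: jacobi_def)

lemma ell2_bounded_jacobi: "ell2_bounded (J t) (4 * (K + 1))"
  by (rule ell2_bounded_banded) (auto simp: jacobi_const cmod_jacobi_le)

lemma imat_norm_jacobi_le: "imat_norm (J t) \<le> 4 * (K + 1)"
  using K(1) by (intro imat_norm_le ell2_bounded_jacobi) auto

lemma imat_norm_jacobi_nonneg: "0 \<le> imat_norm (J t)"
  by (rule imat_norm_nonneg[OF upper_band_jacobi ell2_bounded_jacobi])

lemma ell2_bounded_jacobi_norm: "imat_norm (J t) \<le> r \<Longrightarrow> ell2_bounded (J t) r"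
  by (rule ell2_bounded_mono[OF ell2_bounded_imat_norm[OF upper_band_jacobi ell2_bounded_jacobi]])

definition resolvent :: "complex \<Rightarrow> real \<Rightarrow> inf_matrix" where
  "resolvent z t = imat_inverse (\<lambda>i j. z * imat_one i j - J t i j)"

lemma resolvent_sums:
  assumes "imat_norm (J t) < cmod z"
  shows "(\<lambda>n. imat_power (J t) n p q / z ^ Suc n) sums resolvent z t p q"
proof -
  note J = ell2_bounded_jacobi_norm[OF order_refl, of t] imat_norm_jacobi_nonneg[of t] assms
  show ?thesis
    unfolding resolvent_def imat_inverse_neumann[OF upper_band_jacobi J]
    by (rule summable_sums[OF summable_neumann[OF J]])
qed

text \<open>The generating series of the commutators, summed by means of
  \<open>commutator_power\<close>: the shifted power gives
  \<open>z * resolvent z t - imat_one\<close>. Its leading block is the right-hand side of the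
  resolvent equation.\<close>

definition resolvent_deriv :: "complex \<Rightarrow> real \<Rightarrow> inf_matrix" where
  "resolvent_deriv z t p q = z * resolvent z t p q - imat_one p q
     - (\<Sum>k\<le>q. resolvent z t p k * J t k q) - (\<Sum>k<p. J t p k * resolvent z t k q)"

abbreviation "comm n t \<equiv> imat_commutator (imat_power (J t) n) (L t)"

lemma resolvent_deriv_sums:
  assumes "imat_norm (J t) < cmod z"
  shows "(\<lambda>n. comm n t p q / z ^ Suc n) sums resolvent_deriv z t p q"
proof -
  note R = resolvent_sums[OF assms]
  have z: "z \<noteq> 0" using assms imat_norm_jacobi_nonneg[of t] by auto
  have "(\<lambda>n. imat_power (J t) n p q / z ^ n) sums (z * resolvent z t p q)"
    using sums_mult[OF R[of p q], of z] z by simp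
  then have "(\<lambda>n. imat_power (J t) (Suc n) p q / z ^ Suc n) sums (z * resolvent z t p q - imat_one p q)"
    by (subst sums_Suc_iff) simp
  then have "(\<lambda>n. imat_power (J t) (Suc n) p q / z ^ Suc n
       - (\<Sum>k\<le>q. imat_power (J t) n p k / z ^ Suc n * J t k q)
       - (\<Sum>k<p. J t p k * (imat_power (J t) n k q / z ^ Suc n))) sums resolvent_deriv z t p q"
    unfolding resolvent_deriv_def
    by (intro sums_diff sums_sum sums_mult sums_mult2 R)
  then show ?thesis
    by (simp add: commutator_power diff_divide_distrib sum_divide_distrib
        del: power_Suc imat_power.simps)
qed

text \<open>The power \<open>n + 1\<close> accounts for \<open>r\<close>; each of the
  \<open>Suc q + p\<close> other products has a factor from \<open>J\<close>, at most
  \<open>K + 1\<close>. For fixed \<open>r\<close> the constant is independent of \<open>n\<close>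
  and \<open>t\<close>, which gives a majorant for the series of derivatives.\<close>

lemma cmod_comm_le:
  assumes "imat_norm (J t) \<le> r"
  shows "cmod (comm n t p q) \<le> (r + real (Suc q + p) * (K + 1)) * r ^ n"
proof -
  have r: "0 \<le> r" using assms imat_norm_jacobi_nonneg[of t] by linarith
  note P = cmod_imat_power_le[OF ell2_bounded_jacobi_norm[OF assms] r]
  have "cmod (\<Sum>k\<le>q. imat_power (J t) n p k * J t k q) \<le> (\<Sum>k\<le>q. r ^ n * (K + 1))"
    using r P cmod_jacobi_le by (intro sum_norm_le) (auto simp: norm_mult intro!: mult_mono)
  moreover have "cmod (\<Sum>k<p. J t p k * imat_power (J t) n k q) \<le> (\<Sum>k<p. (K + 1) * r ^ n)"
    using r P cmod_jacobi_le K(1) by (intro sum_norm_le) (auto simp: norm_mult intro!: mult_mono)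
  moreover note P[of "Suc n" p q]
  ultimately have "cmod (comm n t p q) \<le> r ^ Suc n + (\<Sum>k\<le>q. r ^ n * (K + 1)) + (\<Sum>k<p. (K + 1) * r ^ n)"
    unfolding commutator_power
    by (intro order_trans[OF norm_triangle_ineq4] add_mono)
  then show ?thesis by (simp add: algebra_simps)
qed

text \<open>Along a solution the entries of \<open>J\<close> have uniformly bounded derivatives,
  which makes \<open>J\<close> Lipschitz continuous in the operator norm.\<close>

lemma imat_norm_lipschitz:
  assumes "lax_equation a b c"
  shows "imat_norm (J s) \<le> imat_norm (J t) + 4 * ((2 * K * K + 2 * K) * \<bar>s - t\<bar>)"
proof -
  \<comment> \<open>The worst entry of the commutator is on the first subdiagonal:
    \<open>2 * K * K\<close> from the product and \<open>2 * K\<close> from the difference of two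
    values of \<open>c\<close>.\<close>
  define B where "B = 2 * K * K + 2 * K"
  have bc: "cmod (b n t) \<le> K" "cmod (c n t) \<le> K" for n t
    using K zero by (cases n; force)+
  have comm: "cmod (imat_commutator (J t) (L t) i j) \<le> B" for t i j
  proof -
    have 1: "cmod (a n t - a m t) \<le> 2 * K" if "n \<ge> 1" "m \<ge> 1" for n m
      using norm_triangle_ineq4[of "a n t" "a m t"] K(2)[OF that(1), of t] K(2)[OF that(2), of t] by linarith
    have 2: "cmod (x * (a n t - a m t)) \<le> 2 * K * K" if "n \<ge> 1" "m \<ge> 1" "cmod x \<le> K" for n m x
      using mult_mono[OF that(3) 1[OF that(1,2)]] K(1) by (simp add: norm_mult mult_ac)
    have 3: "cmod (b n t - b m t) \<le> 2 * K" "cmod (c n t - c m t) \<le> 2 * K" for n m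
      using norm_triangle_ineq4[of "b n t" "b m t"] norm_triangle_ineq4[of "c n t" "c m t"]
        bc[of n t] bc[of m t] by linarith+
    have "0 \<le> K * K" using K(1) by simp
    then have "cmod (b (j + 1) t - b j t) \<le> B"
      "cmod (c (j + 1) t * (a (j + 3) t - a (j + 1) t)) \<le> B" "0 \<le> B"
      using 3(1)[of "j + 1" j] 2[OF _ _ bc(2)[of "j + 1" t], of "j + 3" "j + 1"] K(1)
      unfolding B_def by linarith+
    moreover have "cmod (b (j + 1) t * (a (j + 2) t - a (j + 1) t) + c (j + 1) t - c j t) \<le> B"
      using 3(2)[of "j + 1" j] 2[OF _ _ bc(1)[of "j + 1" t], of "j + 2" "j + 1"]
       norm_triangle_ineq[of "b (j + 1) t * (a (j + 2) t - a (j + 1) t)" "c (j + 1) t - c j t"]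
      unfolding B_def by (simp add: add_diff_eq)
    ultimately show ?thesis by (simp add: commutator_jacobi)
  qed
  have "cmod (J s i j - J t i j) \<le> B * \<bar>s - t\<bar>" for i j
  proof -
    have "cmod (J s i j - J t i j) \<le> B * norm (s - t)"
    proof (rule differentiable_bound[of UNIV])
      fix u
      show "((\<lambda>s. J s i j) has_derivative (\<lambda>h. h *\<^sub>R imat_commutator (J u) (L u) i j)) (at u)"
        using assms by (simp add: lax_equation_def has_vector_derivative_def)
      show "onorm (\<lambda>h::real. h *\<^sub>R imat_commutator (J u) (L u) i j) \<le> B"
        using comm[of u i j] order_trans[OF norm_ge_zero comm]
        by (intro onorm_bound) (auto simp: mult.commute[of _ "norm _"] intro!: mult_right_mono)
    qed auto
    then show ?thesis by simp
  qed
  then have "ell2_bounded (\<lambda>i j. J s i j - J t i j) (4 * (B * \<bar>s - t\<bar>))"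
    by (intro ell2_bounded_banded) (auto simp: jacobi_const)
  then show ?thesis
    unfolding B_def[symmetric] using K(1)
    by (intro imat_norm_perturbation[OF upper_band_jacobi ell2_bounded_jacobi upper_band_jacobi])
       (auto simp: B_def)
qed

lemma resolvent_derivative_of_toda:
  assumes toda: "toda_system a b c" and z: "imat_norm (J t) < cmod z" and pq: "p < 2" "q < 2"
  shows "((\<lambda>s. resolvent z s p q) has_vector_derivative resolvent_deriv z t p q) (at t)"
proof -
  \<comment> \<open>\<open>B\<close> is the Lipschitz constant of the norm, \<open>r\<close> lies
    midway between the norm at \<open>t\<close> and \<open>cmod z\<close>, and
    \<open>\<delta>\<close> keeps the norm at most \<open>r\<close> on the ball, so one majorant
    serves there.\<close>
  define B where "B = 4 * (2 * K * K + 2 * K)"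
  define r where "r = (imat_norm (J t) + cmod z) / 2"
  define \<delta> where "\<delta> = (r - imat_norm (J t)) / B"
  have B: "B > 0" using K(1) by (simp add: B_def add_pos_pos)
  have r: "imat_norm (J t) < r" "r < cmod z" using z by (auto simp: r_def)
  have r0: "0 \<le> r" using r imat_norm_jacobi_nonneg[of t] by linarith
  have \<delta>: "\<delta> > 0" using r B by (simp add: \<delta>_def)
  let ?S = "ball t \<delta>"
  have le: "imat_norm (J s) \<le> r" if "s \<in> ?S" for s
  proof -
    have "imat_norm (J s) \<le> imat_norm (J t) + B * \<bar>s - t\<bar>"
      using imat_norm_lipschitz[of s t] toda unfolding toda_iff_lax B_def by (simp only: mult.assoc)
    also have "\<dots> \<le> imat_norm (J t) + B * \<delta>"
      using that B by (intro add_left_mono mult_left_mono) (auto simp: dist_real_def)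
    finally show ?thesis using B by (simp add: \<delta>_def)
  qed
  let ?M = "\<lambda>n. (r + real (Suc q + p) * (K + 1)) * (r ^ n / cmod z ^ Suc n)"
  have deriv: "((\<lambda>s. imat_power (J s) n p q / z ^ Suc n) has_vector_derivative
      comm n s p q / z ^ Suc n) (at s within ?S)" for n s
    by (rule has_vector_derivative_divide[OF has_vector_derivative_at_within])
       (rule toda[unfolded toda_iff_power_derivative, rule_format, OF pq])
  have bound: "norm (comm n s p q / z ^ Suc n) \<le> ?M n" if "s \<in> ?S" for n s
    using divide_right_mono[OF cmod_comm_le[OF le[OF that], of n p q], of "cmod z ^ Suc n"]
    by (simp add: norm_divide norm_power norm_mult del: power_Suc)
  have M: "summable ?M"
    by (rule summable_mult[OF summable_neumann_bound[OF r0 r(2)]])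
  have summable: "summable (\<lambda>n. imat_power (J s) n p q / z ^ Suc n)" if "s \<in> ?S" for s
    by (rule summable_neumann[OF ell2_bounded_jacobi_norm[OF le[OF that]] r0 r(2)])
  have "((\<lambda>s. \<Sum>n. imat_power (J s) n p q / z ^ Suc n) has_vector_derivative
          (\<Sum>n. comm n t p q / z ^ Suc n)) (at t within ?S)"
    by (rule has_vector_derivative_suminf[where f' = "\<lambda>n s. comm n s p q / z ^ Suc n" and M = ?M])
       (simp_all only: convex_ball centre_in_ball \<delta> deriv bound M summable)
  then have "((\<lambda>s. \<Sum>n. imat_power (J s) n p q / z ^ Suc n) has_vector_derivative
          resolvent_deriv z t p q) (at t)"
    using \<delta> by (simp only: at_within_open[OF _ open_ball] centre_in_ball
         sums_unique[OF resolvent_deriv_sums[OF z], symmetric])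
  then show ?thesis
  proof (rule has_vector_derivative_transform_within_open[of _ _ _ ?S])
    fix s assume "s \<in> ?S"
    then have "imat_norm (J s) < cmod z" using le r by force
    from sums_unique[OF resolvent_sums[OF this]]
    show "(\<Sum>n. imat_power (J s) n p q / z ^ Suc n) = resolvent z s p q" by simp
  qed (use \<delta> in auto)
qed

text \<open>The commutators involve only \<open>J\<close> and its powers, not their derivatives, so
  they are continuous and can be integrated.\<close>

lemma continuous_on_comm: "continuous_on S (\<lambda>t. comm n t p q)"
proof -
  have J: "continuous_on S (\<lambda>t. J t i j)" for i j
    using has_vector_derivative_continuous[OF jacobi_has_vector_derivative]
    by (intro continuous_at_imp_continuous_on) blast
  have P: "continuous_on S (\<lambda>t. imat_power (J t) n i j)" for n i j
    using has_vector_derivative_continuous[OF power_has_vector_derivative]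
    by (intro continuous_at_imp_continuous_on) blast
  show ?thesis
    unfolding commutator_power by (intro continuous_intros J P)
qed

text \<open>The primitives \<open>G n\<close> of the commutators have the same generating series as the powers of \<open>J\<close>,
  so uniqueness of power series coefficients identifies them.\<close>

lemma power_derivative_of_resolvent:
  assumes res: "\<And>t z. imat_norm (J t) < cmod z \<Longrightarrow>
      ((\<lambda>s. resolvent z s p q) has_vector_derivative resolvent_deriv z t p q) (at t)"
  shows "((\<lambda>s. imat_power (J s) n p q) has_vector_derivative comm n t p q) (at t)"
proof -
  \<comment> \<open>A compact interval around \<open>t\<close>; its length 2 gives the factor 2 in
    the majorant below.\<close>
  define l u where "l = t - 1" and "u = t + 1"
  define G where "G n s = imat_power (J l) n p q + integral {l..s} (\<lambda>s. comm n s p q)" for n s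
  define r where "r = 4 * (K + 1)"
  have r: "0 < r" "imat_norm (J s) \<le> r" for s
    using K(1) imat_norm_jacobi_le by (auto simp: r_def)
  have G: "(G n has_vector_derivative comm n s p q) (at s within {l..u})" if "s \<in> {l..u}" for n s
    unfolding G_def using that
    by (auto intro!: derivative_eq_intros integral_has_vector_derivative continuous_on_comm)
  have eq: "imat_power (J s) n p q = G n s" if s: "s \<in> {l..u}" for n s
  proof -
    have "imat_power (J s) n p q - G n s = 0"
    proof (rule sums_inverse_powers_eq_0[OF _ r(1)])
      fix z assume z: "r < cmod z"
      have less: "imat_norm (J s) < cmod z" for s using r(2)[of s] z by simp
      let ?M = "\<lambda>n. (r + real (Suc q + p) * (K + 1)) * (r ^ n / cmod z ^ Suc n)"
      have M: "summable ?M" using r(1) z by (intro summable_mult summable_neumann_bound) auto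
      have bound: "norm (comm n s p q / z ^ Suc n) \<le> ?M n" for n s
        using divide_right_mono[OF cmod_comm_le[OF r(2), of s n p q], of "cmod z ^ Suc n"]
        by (simp add: norm_divide norm_power norm_mult del: power_Suc)
      have sumG: "summable (\<lambda>n. G n s / z ^ Suc n)" if s: "s \<in> {l..u}" for s
      proof -
        have "norm (integral {l..s} (\<lambda>s. comm n s p q) / z ^ Suc n) \<le> 2 * ?M n" for n
        proof -
          have "norm (integral {l..s} (\<lambda>s. comm n s p q)) \<le> ((r + real (Suc q + p) * (K + 1)) * r ^ n) * (s - l)"
            using s by (intro integral_bound continuous_on_comm cmod_comm_le r) auto
          also have "\<dots> \<le> ((r + real (Suc q + p) * (K + 1)) * r ^ n) * 2"
            using s r(1) K(1) by (intro mult_left_mono) (auto simp: l_def u_def)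
          finally have "norm (integral {l..s} (\<lambda>s. comm n s p q)) \<le> ((r + real (Suc q + p) * (K + 1)) * r ^ n) * 2" .
          from divide_right_mono[OF this, of "cmod z ^ Suc n"] show ?thesis
            by (simp add: norm_divide norm_power norm_mult mult_ac del: power_Suc)
        qed
        then have "summable (\<lambda>n. integral {l..s} (\<lambda>s. comm n s p q) / z ^ Suc n)"
          by (intro summable_comparison_test'[OF summable_mult[OF M, of 2]])
        from summable_add[OF sums_summable[OF resolvent_sums[OF less[of l], of p q]] this] show ?thesis
          by (simp add: G_def add_divide_distrib del: power_Suc)
      qed
      \<comment> \<open>The resolvent has this derivative by hypothesis, the series of the
        \<open>G n\<close> by termwise differentiation, since the bounds on the commutators supply a
        majorant.\<close>
      have const: "((\<lambda>s. resolvent z s p q - (\<Sum>n. G n s / z ^ Suc n)) has_vector_derivative 0) (at s within {l..u})"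
        if s: "s \<in> {l..u}" for s
      proof -
        have "((\<lambda>s. \<Sum>n. G n s / z ^ Suc n) has_vector_derivative (\<Sum>n. comm n s p q / z ^ Suc n)) (at s within {l..u})"
          by (rule has_vector_derivative_suminf[where M = ?M and f' = "\<lambda>n s. comm n s p q / z ^ Suc n"])
             (use s G bound M sumG in \<open>auto intro!: has_vector_derivative_divide simp del: power_Suc\<close>)
        then have "((\<lambda>s. \<Sum>n. G n s / z ^ Suc n) has_vector_derivative resolvent_deriv z s p q) (at s within {l..u})"
          by (simp add: sums_unique[OF resolvent_deriv_sums[OF less], symmetric] del: power_Suc)
        from has_vector_derivative_diff[OF has_vector_derivative_at_within[OF res[OF less]] this]
        show ?thesis by simp
      qed
      have "\<exists>k. \<forall>s\<in>{l..u}. resolvent z s p q - (\<Sum>n. G n s / z ^ Suc n) = k"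
        by (rule has_derivative_zero_constant)
           (use const in \<open>simp_all add: has_vector_derivative_def del: power_Suc\<close>)
      then obtain k where k: "\<And>s. s \<in> {l..u} \<Longrightarrow> resolvent z s p q - (\<Sum>n. G n s / z ^ Suc n) = k"
        by blast
      \<comment> \<open>At the left end the integrals vanish, so the constant \<open>k\<close> is
        0.\<close>
      have "(\<Sum>n. G n l / z ^ Suc n) = resolvent z l p q"
        unfolding G_def by (simp add: sums_unique[OF resolvent_sums[OF less], symmetric] del: power_Suc)
      then have "(\<Sum>n. G n s / z ^ Suc n) = resolvent z s p q"
        using k[of l] k[OF s] by (simp add: l_def u_def)
      with sums_diff[OF resolvent_sums[OF less, of s p q] summable_sums[OF sumG[OF s]]]
      show "(\<lambda>n. (imat_power (J s) n p q - G n s) / z ^ Suc n) sums 0"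
        by (simp add: diff_divide_distrib del: power_Suc)
    qed
    then show ?thesis by simp
  qed
  have "(G n has_vector_derivative comm n t p q) (at t within {l<..<u})"
    by (rule has_vector_derivative_within_subset[OF G]) (auto simp: l_def u_def)
  then have "(G n has_vector_derivative comm n t p q) (at t)"
    by (simp add: at_within_open[OF _ open_greaterThanLessThan] l_def u_def)
  then show ?thesis
    by (rule has_vector_derivative_transform_within_open[of _ _ _ "{l<..<u}"])
       (auto simp: eq l_def u_def)
qed

lemma toda_iff_resolvent_derivative:
  "toda_system a b c \<longleftrightarrow> (\<forall>t z. imat_norm (J t) < cmod z \<longrightarrow> (\<forall>p<2. \<forall>q<2.
     ((\<lambda>s. resolvent z s p q) has_vector_derivative resolvent_deriv z t p q) (at t)))"
proof
  assume "toda_system a b c"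
  then show "\<forall>t z. imat_norm (J t) < cmod z \<longrightarrow> (\<forall>p<2. \<forall>q<2.
     ((\<lambda>s. resolvent z s p q) has_vector_derivative resolvent_deriv z t p q) (at t))"
    by (intro allI impI resolvent_derivative_of_toda)
next
  assume "\<forall>t z. imat_norm (J t) < cmod z \<longrightarrow> (\<forall>p<2. \<forall>q<2.
     ((\<lambda>s. resolvent z s p q) has_vector_derivative resolvent_deriv z t p q) (at t))"
  then show "toda_system a b c"
    unfolding toda_iff_power_derivative by (intro allI impI power_derivative_of_resolvent) auto
qed

end

section \<open>The recurrence polynomials and \<open>2 \<times> 2\<close> blocks\<close>

lemma has_vector_derivative_vec_iff:
  fixes f :: "real \<Rightarrow> 'a::real_normed_vector ^ 'n"
  shows "(f has_vector_derivative f') (at t within S) \<longleftrightarrow>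
    (\<forall>i. ((\<lambda>s. f s $ i) has_vector_derivative f' $ i) (at t within S))"
proof
  assume "(f has_vector_derivative f') (at t within S)"
  then show "\<forall>i. ((\<lambda>s. f s $ i) has_vector_derivative f' $ i) (at t within S)"
    using bounded_linear.has_vector_derivative[OF bounded_linear_vec_nth] by blast
next
  assume "\<forall>i. ((\<lambda>s. f s $ i) has_vector_derivative f' $ i) (at t within S)"
  then show "(f has_vector_derivative f') (at t within S)"
    unfolding has_vector_derivative_def has_derivative_within
    by (auto intro!: vec_tendstoI bounded_linear_scaleR_left)
qed

lemma mat2_nth [simp]:
  "mat2 p q r s $ 1 $ 1 = p" "mat2 p q r s $ 1 $ 2 = q"
  "mat2 p q r s $ 2 $ 1 = r" "mat2 p q r s $ 2 $ 2 = s"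
  by (simp_all add: mat2_def)

lemma all_less_2: "(\<forall>p<(2::nat). Q p) \<longleftrightarrow> Q 0 \<and> Q 1"
  by (auto simp: less_2_cases_iff)

lemma block_has_vector_derivative_iff:
  "((\<lambda>s. block (M s) 1 1) has_vector_derivative block D 1 1) (at t) \<longleftrightarrow>
    (\<forall>p<2. \<forall>q<2. ((\<lambda>s. M s p q) has_vector_derivative D p q) (at t))"
  by (simp add: has_vector_derivative_vec_iff forall_2 block_def all_less_2)

context jacobi_coefficients
begin

text \<open>\<open>B_mat a b t 1\<close> minus the leading block of \<open>L t\<close> is the upper
  triangular part of the leading block of \<open>J\<close>. Multiplying by it on the right and by
  the block of \<open>L t\<close> on the left gives the two sums in
  \<open>commutator_power\<close>.\<close>

lemma block_commutator_power:
  "block (imat_power (J t) (n + 1)) 1 1 - block (imat_power (J t) n) 1 1 ** B_mat a b t 1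
     + commutator2 (block (imat_power (J t) n) 1 1) (block (L t) 1 1)
   = block (imat_commutator (imat_power (J t) n) (L t)) 1 1"
  by (simp add: vec_eq_iff forall_2 block_def B_mat_def commutator2_def matrix_matrix_mult_def
      sum_2 commutator_power lower_part_def jacobi_def numeral_2_eq_2 algebra_simps
      del: imat_power.simps)

lemma toda_iff_moment: "toda_system a b c \<longleftrightarrow> moment_equation a b c"
  unfolding moment_equation_def block_commutator_power block_has_vector_derivative_iff
    toda_iff_power_derivative by blast

section \<open>The recurrence polynomials and their derivatives in \<open>t\<close>\<close>

abbreviation P :: "real \<Rightarrow> complex \<Rightarrow> nat \<Rightarrow> complex" where
  "P t z n \<equiv> poly (rec_poly a b c t n) z"

lemma P_Suc:
  "P t z (Suc n) = (z - a (n + 1) t) * P t z n - b n t * P t z (n - 1) - c (n - 1) t * P t z (n - 2)"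
proof -
  consider "n = 0" | "n = 1" | m where "n = Suc (Suc m)"
    by (metis One_nat_def not0_implies_Suc)
  then show ?thesis
    by cases (simp_all add: zero numeral_2_eq_2 numeral_3_eq_3 algebra_simps)
qed

lemma coeff_rec_poly: "coeff (rec_poly a b c t n) n = 1 \<and> (\<forall>k>n. coeff (rec_poly a b c t n) k = 0)"
proof (induction n rule: less_induct)
  case (less n)
  consider "n = 0" | "n = 1" | "n = 2" | m where "n = Suc (Suc (Suc m))"
    by (metis One_nat_def not0_implies_Suc numeral_2_eq_2)
  then show ?case
  proof cases
    case (4 m)
    then show ?thesis
      using less[of m] less[of "Suc m"] less[of "Suc (Suc m)"]
      by (auto simp: coeff_pCons split: nat.splits)
  qed (auto simp: numeral_2_eq_2 coeff_pCons split: nat.splits)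
qed

text \<open>\<open>rec_poly\<close> is monic of degree equal to its index, so the coefficients of
  degree \<open>n + 2\<close>, \<open>n + 1\<close> and \<open>n\<close> give \<open>x\<close>,
  \<open>y\<close> and \<open>w\<close> in turn.\<close>

lemma P_independent:
  assumes "\<And>z. x * P t z (Suc (Suc n)) + y * P t z (Suc n) + w * P t z n = 0"
  shows "x = 0" "y = 0" "w = 0"
proof -
  let ?R = "rec_poly a b c t"
  define R where "R = smult x (?R (Suc (Suc n))) + smult y (?R (Suc n)) + smult w (?R n)"
  have "poly R z = 0" for z
    unfolding R_def using assms[of z] by simp
  then have R: "R = 0" using poly_all_0_iff_0 by blast
  note C = coeff_rec_poly[of t "Suc (Suc n)"] coeff_rec_poly[of t "Suc n"] coeff_rec_poly[of t n]
  from R have "coeff R (Suc (Suc n)) = 0" by simp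
  with C show x: "x = 0" by (simp add: R_def del: rec_poly.simps)
  from R have "coeff R (Suc n) = 0" by simp
  with C x show y: "y = 0" by (simp add: R_def del: rec_poly.simps)
  from R have "coeff R n = 0" by simp
  with C x y show "w = 0" by (simp add: R_def del: rec_poly.simps)
qed

text \<open>Entry \<open>n\<close> of \<open>- L P\<close>; the entries \<open>2 * n\<close> and
  \<open>2 * n + 1\<close> form the right-hand side of the vector equation.\<close>

definition P_deriv :: "real \<Rightarrow> complex \<Rightarrow> nat \<Rightarrow> complex" where
  "P_deriv t z n = - (c (n - 1) t * P t z (n - 2)) - b n t * P t z (n - 1)"

text \<open>With \<open>a'\<close>, \<open>b'\<close>, \<open>c'\<close> left free, the bracket is
  row \<open>m + 2\<close> of \<open>E P\<close>. Under the system it vanishes; conversely,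
  uniqueness of the derivative makes it vanish, and independence then makes each factor
  zero.\<close>

lemma P_deriv_of_recurrence:
  assumes P: "\<And>k. k \<in> {m, Suc m, Suc (Suc m)} \<Longrightarrow>
      ((\<lambda>s. P s z k) has_vector_derivative P_deriv t z k) (at t)"
    and a: "(a (m + 3) has_vector_derivative a') (at t)"
    and b: "(b (m + 2) has_vector_derivative b') (at t)"
    and c: "(c (m + 1) has_vector_derivative c') (at t)"
  shows "((\<lambda>s. P s z (m + 3)) has_vector_derivative
     P_deriv t z (m + 3)
      - ((a' - (b (m + 3) t - b (m + 2) t)) * P t z (Suc (Suc m))
       + (b' - (b (m + 2) t * (a (m + 3) t - a (m + 2) t) + c (m + 2) t - c (m + 1) t)) * P t z (Suc m)
       + (c' - c (m + 1) t * (a (m + 3) t - a (m + 1) t)) * P t z m)) (at t)"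
proof -
  have rec: "P s z (m + 3) = (z - a (m + 3) s) * P s z (Suc (Suc m)) - b (m + 2) s * P s z (Suc m)
      - c (m + 1) s * P s z m" for s
    by (simp add: numeral_3_eq_3 algebra_simps)
  \<comment> \<open>The factor \<open>z - a (m + 3) t\<close> meets \<open>P_deriv\<close> at
    \<open>m + 2\<close> and produces \<open>z * P t z m\<close> and
    \<open>z * P t z (m + 1)\<close>, which \<open>P1\<close> and \<open>P2\<close>
    eliminate.\<close>
  have P1: "P t z (Suc m) = (z - a (m + 1) t) * P t z m - b m t * P t z (m - 1) - c (m - 1) t * P t z (m - 2)"
    by (rule P_Suc)
  have P2: "P t z (Suc (Suc m)) = (z - a (m + 2) t) * P t z (Suc m) - b (m + 1) t * P t z m - c m t * P t z (m - 1)"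
    using P_Suc[where n = "Suc m" and t = t and z = z] by simp
  have d0: "P_deriv t z m = - (c (m - 1) t * P t z (m - 2)) - b m t * P t z (m - 1)"
    by (simp add: P_deriv_def)
  have d1: "P_deriv t z (Suc m) = - (c m t * P t z (m - 1)) - b (m + 1) t * P t z m"
    by (simp add: P_deriv_def)
  have d2: "P_deriv t z (Suc (Suc m)) = - (c (m + 1) t * P t z m) - b (m + 2) t * P t z (Suc m)"
    by (simp add: P_deriv_def del: rec_poly.simps)
  have d3: "P_deriv t z (m + 3) = - (c (m + 2) t * P t z (Suc m)) - b (m + 3) t * P t z (Suc (Suc m))"
    by (simp add: P_deriv_def numeral_3_eq_3 del: rec_poly.simps)
  have "((\<lambda>s. P s z (m + 3)) has_vector_derivative
      (((z - a (m + 3) t) * P_deriv t z (Suc (Suc m)) + (0 - a') * P t z (Suc (Suc m)))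
        - (b (m + 2) t * P_deriv t z (Suc m) + b' * P t z (Suc m))
        - (c (m + 1) t * P_deriv t z m + c' * P t z m))) (at t)"
    unfolding rec
    by (rule has_vector_derivative_diff has_vector_derivative_mult has_vector_derivative_const a b c P
        | simp only: insert_iff simp_thms)+
  also have "(((z - a (m + 3) t) * P_deriv t z (Suc (Suc m)) + (0 - a') * P t z (Suc (Suc m)))
        - (b (m + 2) t * P_deriv t z (Suc m) + b' * P t z (Suc m))
        - (c (m + 1) t * P_deriv t z m + c' * P t z m)) =
     P_deriv t z (m + 3)
      - ((a' - (b (m + 3) t - b (m + 2) t)) * P t z (Suc (Suc m))
       + (b' - (b (m + 2) t * (a (m + 3) t - a (m + 2) t) + c (m + 2) t - c (m + 1) t)) * P t z (Suc m)
       + (c' - c (m + 1) t * (a (m + 3) t - a (m + 1) t)) * P t z m)"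
    unfolding d0 d1 d2 d3 using P1 P2 by algebra
  finally show ?thesis .
qed

lemma vec_poly_equation_iff:
  "vec_poly_equation a b c \<longleftrightarrow> (\<forall>n t z. ((\<lambda>s. P s z n) has_vector_derivative P_deriv t z n) (at t))"
proof -
  have *: "((\<lambda>s. vec_poly a b c s (int n) z) has_vector_derivative
        (- (C_mat b c t n *v vec_poly a b c t (int n - 1) z)
         - D_mat b t n *v vec_poly a b c t (int n) z)) (at t) \<longleftrightarrow>
     ((\<lambda>s. P s z (2 * n)) has_vector_derivative P_deriv t z (2 * n)) (at t) \<and>
     ((\<lambda>s. P s z (2 * n + 1)) has_vector_derivative P_deriv t z (2 * n + 1)) (at t)" for n t z
  proof (cases n)
    case 0
    then show ?thesis
      by (simp add: has_vector_derivative_vec_iff forall_2 vec_poly_def P_deriv_def C_mat_def D_mat_def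
        matrix_vector_mult_def sum_2 zero)
  next
    case (Suc m)
    have "nat (1 + int m) = Suc m" by simp
    then show ?thesis
      by (simp add: Suc has_vector_derivative_vec_iff forall_2 vec_poly_def P_deriv_def C_mat_def D_mat_def
        matrix_vector_mult_def sum_2 mult_Suc_right nat_mult_distrib del: rec_poly.simps)
  qed
  have even_odd: "(\<forall>n. Q n) \<longleftrightarrow> (\<forall>n. Q (2 * n) \<and> Q (2 * n + 1))" for Q :: "nat \<Rightarrow> bool"
    by (metis evenE oddE)
  show ?thesis
    unfolding vec_poly_equation_def * by (subst (2) even_odd) blast
qed

text \<open>Induction along the recurrence, whose general form starts at index 3; the indices 0, 1
  and 2 are computed directly.\<close>

lemma toda_imp_P_deriv:
  assumes "toda_system a b c"
  shows "((\<lambda>s. P s z n) has_vector_derivative P_deriv t z n) (at t)"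
proof (induction n rule: less_induct)
  case (less n)
  note abc = assms[unfolded toda_system_def, rule_format]
  have a: "(a n has_vector_derivative b n t - b (n - 1) t) (at t)"
    and b: "(b n has_vector_derivative b n t * (a (n + 1) t - a n t) + c n t - c (n - 1) t) (at t)"
    and c: "(c n has_vector_derivative c n t * (a (n + 2) t - a n t)) (at t)" if "n \<ge> 1" for n
    using abc that by blast+
  consider "n = 0" | "n = 1" | "n = 2" | m where "n = m + 3"
    by (metis One_nat_def add_Suc_right add_0_right not0_implies_Suc numeral_2_eq_2 numeral_3_eq_3)
  then show ?case
  proof cases
    case 1
    then show ?thesis by (simp add: P_deriv_def zero)
  next
    case 2
    then show ?thesis using has_vector_derivative_minus[OF a[of 1]]
      by (auto simp: P_deriv_def zero intro!: derivative_eq_intros a)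
  next
    case 3
    have "((\<lambda>s. (z - a 2 s) * (z - a 1 s) - b 1 s) has_vector_derivative
       ((z - a 2 t) * (0 - (b 1 t - b 0 t)) + (0 - (b 2 t - b 1 t)) * (z - a 1 t)
        - (b 1 t * (a 2 t - a 1 t) + c 1 t - c 0 t))) (at t)"
      using a[of 1] a[of 2] b[of 1]
      by (intro has_vector_derivative_diff has_vector_derivative_mult has_vector_derivative_const)
        (simp_all add: numeral_2_eq_2)
    then show ?thesis
      by (simp add: 3 P_deriv_def numeral_2_eq_2 zero algebra_simps)
  next
    case (4 m)
    have "((\<lambda>s. P s z k) has_vector_derivative P_deriv t z k) (at t)" if "k \<in> {m, Suc m, Suc (Suc m)}" for k
      by (rule less.IH) (use that 4 in auto)
    from P_deriv_of_recurrence[OF this a b c] show ?thesis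
      unfolding 4 by (simp add: numeral_3_eq_3 del: rec_poly.simps)
  qed
qed

lemma P_deriv_imp_toda:
  assumes P: "\<And>n t z. ((\<lambda>s. P s z n) has_vector_derivative P_deriv t z n) (at t)"
  shows "toda_system a b c"
proof -
  have diff: "(a n has_vector_derivative vector_derivative (a n) (at t)) (at t)"
    "(b n has_vector_derivative vector_derivative (b n) (at t)) (at t)"
    "(c n has_vector_derivative vector_derivative (c n) (at t)) (at t)" if "n \<ge> 1" for n t
    using differentiable[OF that, of t] by (simp_all add: vector_derivative_works)
  let ?a = "\<lambda>n t. b n t - b (n - 1) t"
  let ?b = "\<lambda>n t. b n t * (a (n + 1) t - a n t) + c n t - c (n - 1) t"
  let ?c = "\<lambda>n t. c n t * (a (n + 2) t - a n t)"
  \<comment> \<open>The general recurrence yields \<open>a\<close> from index 3, \<open>b\<close>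
    from 2 and \<open>c\<close> from 1; \<open>a 1\<close>, \<open>a 2\<close> and
    \<open>b 1\<close> come from the polynomials of degree 1 and 2.\<close>
  have large: "vector_derivative (a (m + 3)) (at t) = ?a (m + 3) t"
    "vector_derivative (b (m + 2)) (at t) = ?b (m + 2) t"
    "vector_derivative (c (m + 1)) (at t) = ?c (m + 1) t" for m t
  proof -
    let ?x = "vector_derivative (a (m + 3)) (at t) - (b (m + 3) t - b (m + 2) t)"
    let ?y = "vector_derivative (b (m + 2)) (at t)
       - (b (m + 2) t * (a (m + 3) t - a (m + 2) t) + c (m + 2) t - c (m + 1) t)"
    let ?w = "vector_derivative (c (m + 1)) (at t) - c (m + 1) t * (a (m + 3) t - a (m + 1) t)"
    have "?x * P t z (Suc (Suc m)) + ?y * P t z (Suc m) + ?w * P t z m = 0" for z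
    proof -
      have "P_deriv t z (m + 3) = P_deriv t z (m + 3)
         - (?x * P t z (Suc (Suc m)) + ?y * P t z (Suc m) + ?w * P t z m)"
        by (rule vector_derivative_unique_at[OF P P_deriv_of_recurrence[OF P diff(1) diff(2) diff(3)]]) auto
      then show ?thesis by algebra
    qed
    from P_independent[OF this]
    show "vector_derivative (a (m + 3)) (at t) = ?a (m + 3) t"
    "vector_derivative (b (m + 2)) (at t) = ?b (m + 2) t"
    "vector_derivative (c (m + 1)) (at t) = ?c (m + 1) t"
      by (simp_all add: numeral_3_eq_3 eval_nat_numeral)
  qed
  have one: "vector_derivative (a 1) (at t) = ?a 1 t" for t
  proof -
    have "((\<lambda>s. 0 - a 1 s) has_vector_derivative (0 - vector_derivative (a 1) (at t))) (at t)"
      by (intro has_vector_derivative_diff has_vector_derivative_const diff) simp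
    then have "0 - vector_derivative (a 1) (at t) = P_deriv t 0 1"
      by (rule vector_derivative_unique_at) (use P[where n = 1 and z = 0 and t = t] in simp)
    then show ?thesis by (simp add: P_deriv_def zero)
  qed
  have two: "vector_derivative (a 2) (at t) = ?a 2 t" "vector_derivative (b 1) (at t) = ?b 1 t" for t
  proof -
    \<comment> \<open>The identity is affine in \<open>z\<close>: \<open>z = a 1 t\<close> isolates
      the derivative of \<open>b 1\<close>, then \<open>z = a 1 t + 1\<close> that of
      \<open>a 2\<close>.\<close>
    have *: "(vector_derivative (a 2) (at t) - ?a 2 t) * (z - a 1 t) =
      ?b 1 t - vector_derivative (b 1) (at t)" for z
    proof -
      have "((\<lambda>s. (z - a 2 s) * (z - a 1 s) - b 1 s) has_vector_derivative
        ((z - a 2 t) * (0 - ?a 1 t) + (0 - vector_derivative (a 2) (at t)) * (z - a 1 t)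
         - vector_derivative (b 1) (at t))) (at t)"
        using diff(1)[of 1 t] unfolding one
        by (intro has_vector_derivative_diff has_vector_derivative_mult has_vector_derivative_const diff) auto
      moreover have "((\<lambda>s. (z - a 2 s) * (z - a 1 s) - b 1 s) has_vector_derivative P_deriv t z 2) (at t)"
        using P[where n = 2 and z = z and t = t] by (simp add: numeral_2_eq_2 algebra_simps)
      ultimately have "(z - a 2 t) * (0 - ?a 1 t) + (0 - vector_derivative (a 2) (at t)) * (z - a 1 t)
         - vector_derivative (b 1) (at t) = P_deriv t z 2"
        by (rule vector_derivative_unique_at)
      then show ?thesis
        by (simp add: P_deriv_def zero numeral_2_eq_2 algebra_simps)
    qed
    from *[of "a 1 t"] show "vector_derivative (b 1) (at t) = ?b 1 t" by simp
    with *[of "a 1 t + 1"] show "vector_derivative (a 2) (at t) = ?a 2 t" by simp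
  qed
  have "vector_derivative (a n) (at t) = ?a n t" if n: "n \<ge> 1" for n t
  proof -
    consider "n = 1" | "n = 2" | m where "n = m + 3"
      using n by (metis One_nat_def add_Suc_right add_0_right not0_implies_Suc numeral_2_eq_2
          numeral_3_eq_3 not_one_le_zero)
    then show ?thesis by cases (simp_all only: one two large)
  qed
  moreover have "vector_derivative (b n) (at t) = ?b n t" if n: "n \<ge> 1" for n t
  proof -
    consider "n = 1" | m where "n = m + 2"
      using n by (metis One_nat_def add_Suc_right add_0_right not0_implies_Suc numeral_2_eq_2
          not_one_le_zero)
    then show ?thesis by cases (simp_all only: two large)
  qed
  moreover have "vector_derivative (c n) (at t) = ?c n t" if n: "n \<ge> 1" for n t
    using large(3)[of "n - 1" t] n by simp
  ultimately show ?thesis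
    unfolding toda_system_def using diff by metis
qed

lemma toda_iff_vec_poly: "toda_system a b c \<longleftrightarrow> vec_poly_equation a b c"
  unfolding vec_poly_equation_iff using toda_imp_P_deriv P_deriv_imp_toda by blast

end

context bounded_jacobi
begin

lemma block_resolvent_deriv:
  "resolvent_block (J t) z ** (mat z - B_mat a b t 1) - mat 1
     + commutator2 (resolvent_block (J t) z) (block (L t) 1 1)
   = block (resolvent_deriv z t) 1 1"
  unfolding resolvent_block_def resolvent_def[symmetric]
  by (simp add: vec_eq_iff forall_2 block_def B_mat_def commutator2_def matrix_matrix_mult_def
      sum_2 resolvent_deriv_def lower_part_def jacobi_def mat_def imat_one_def numeral_2_eq_2 algebra_simps)

lemma toda_iff_resolvent: "toda_system a b c \<longleftrightarrow> resolvent_equation a b c"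
  unfolding resolvent_equation_def block_resolvent_deriv
  unfolding resolvent_block_def resolvent_def[symmetric] block_has_vector_derivative_iff
    toda_iff_resolvent_derivative by blast

end

theorem theorem1:
  fixes a b c :: "nat \<Rightarrow> real \<Rightarrow> complex"
  assumes differentiable: "\<And>n t. n \<ge> 1 \<Longrightarrow>
      a n differentiable (at t) \<and> b n differentiable (at t) \<and> c n differentiable (at t)"
    and bounded: "\<exists>K::real. K > 0 \<and>
      (\<forall>n\<ge>1. \<forall>t. max (cmod (a n t)) (max (cmod (b n t)) (cmod (c n t))) \<le> K)"
    and nonzero: "\<And>n t. n \<ge> 1 \<Longrightarrow> c n t \<noteq> 0"
    and zero: "\<And>t. b 0 t = 0" "\<And>t. c 0 t = 0"
  shows "(toda_system a b c \<longleftrightarrow> lax_equation a b c)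
    \<and> (toda_system a b c \<longleftrightarrow> moment_equation a b c)
    \<and> (toda_system a b c \<longleftrightarrow> resolvent_equation a b c)
    \<and> (toda_system a b c \<longleftrightarrow> vec_poly_equation a b c)"
proof -
  obtain K :: real where K: "K > 0"
      "\<forall>n\<ge>1. \<forall>t. max (cmod (a n t)) (max (cmod (b n t)) (cmod (c n t))) \<le> K"
    using bounded by blast
  interpret bounded_jacobi a b c K
    using differentiable nonzero zero K by unfold_locales auto
  show ?thesis
    using toda_iff_lax toda_iff_moment toda_iff_resolvent toda_iff_vec_poly by blast
qed

end
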